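(* Let $\ell \in \mathbb N$ and let $\delta\in(0,1)$ be a constant. For any subspace $\mathcal V$ of dimension $\delta n^{\ell}$ in $\mathbb R^{n\times n\times\dots\times n}$ ($\ell$ modes), there exist tensors $T_1,\dots,T_r\in\mathcal V$ of unit Frobenius norm such that for random $\rho$-perturbations $\widetilde x^{(1)},\dots,\widetilde x^{(\ell)}\in\mathbb R^n$ of any vectors $x^{(1)},\dots,x^{(\ell)}\in\mathbb R^n$, $$\Pr\left[\exists j\in[r] \text{ s.t. } \left|T_j\left(\widetilde x^{(1)},\dots,\widetilde x^{(\ell)}\right)\right| \ge \rho^{\ell}\left(\frac1n\right)^{3^{\ell}}\right] \ge 1-\exp\left(-\delta n^{1/(2\ell)^{\ell}}\right).$$
   Context: $T(y^{(1)},\dots,y^{(\ell)}) = \sum_{i_1,\dots,i_\ell} T_{i_1\dots i_\ell} y^{(1)}_{i_1}\cdots y^{(\ell)}_{i_\ell}$ is the full multilinear contraction. A $\rho$-perturbation of $x\in\mathbb R^n$ is $x+g$ with $g$ having independent $N(0,\rho^2/n)$ coordinates; the perturbations are independent. *)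

theory Defs
  imports "HOL-Probability.Probability"
begin

text \<open>
  A tensor with modes indexed by \<open>'l\<close>, each of dimension \<open>CARD('n)\<close>, is a vector of reals
  indexed by the multi-indices \<open>'l \<Rightarrow> 'n\<close>. Hence \<^const>\<open>norm\<close> on this type is the Frobenius norm,
  and \<^const>\<open>subspace\<close> and \<^const>\<open>dim\<close> apply directly.
\<close>

type_synonym ('l, 'n) tensor = "real ^ ('l \<Rightarrow> 'n)"

definition contraction :: "('l::finite, 'n::finite) tensor \<Rightarrow> ('l \<Rightarrow> real ^ 'n) \<Rightarrow> real" where
  "contraction T y = (\<Sum>i\<in>UNIV. T $ i * (\<Prod>k\<in>UNIV. y k $ i k))"

text \<open>
  The second parameter of \<^const>\<open>normal_density\<close> is the standard deviation,
  so the variance of each coordinate of the noise is \<open>\<rho>\<^sup>2 / n\<close>.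
\<close>

definition rho_perturbation ::
    "'w measure \<Rightarrow> real \<Rightarrow> real ^ 'n::finite \<Rightarrow> ('w \<Rightarrow> real ^ 'n) \<Rightarrow> bool" where
  "rho_perturbation M \<rho> x X \<longleftrightarrow>
     prob_space.indep_vars M (\<lambda>_. borel) (\<lambda>i \<omega>. (X \<omega> - x) $ i) UNIV \<and>
     (\<forall>i. distributed M lborel (\<lambda>\<omega>. (X \<omega> - x) $ i)
            (normal_density 0 (\<rho> / sqrt (real CARD('n)))))"

end

theory Submission
  imports Defs
begin

text \<open>
  Induction on the number of modes, contracting one mode at a time. If \<open>dim V\<close> exceeds
  \<open>(s - 1) \<cdot> \<ell> \<cdot> n ^ (\<ell> - 1)\<close>, one can choose greedily \<open>s\<close> values \<open>p\<^sub>1, \<dots>, p\<^sub>s\<close> of the index of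
  the new mode and subspaces \<open>U\<^sub>1, \<dots>, U\<^sub>s\<close> of \<open>V\<close>, still large, such that the slice at \<open>p\<^sub>i\<close> carries a
  fixed fraction of the norm of every tensor in \<open>U\<^sub>i\<close>, whereas its slices at \<open>p\<^sub>1, \<dots>, p\<^sub>i\<^sub>-\<^sub>1\<close> vanish.
  Call \<open>i\<close> bad if the induction hypothesis fails for the slices of \<open>U\<^sub>i\<close> at \<open>p\<^sub>i\<close>. After the other modes
  are exposed, the good indices give linear forms in the last vector that are triangular with
  large pivots; exposing its coordinates one by one, all forms are small with probability at
  most \<open>q\<close> to the number of good indices. Convexity of \<open>g \<mapsto> q ^ g\<close> bounds the expectation of this by
  \<open>q ^ s\<close> plus the average probability of being bad, so the failure probability grows only by
  \<open>q ^ s\<close> per mode. For \<open>q = n ^ (- \<ell> - 1)\<close> and \<open>s = \<lceil>\<delta> n / \<ell>\<rceil>\<close> the total \<open>\<ell> q ^ s\<close> is small enough.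
\<close>

subsection \<open>Quadratic forms on subspaces\<close>

text \<open>Orthogonality to \<open>Y\<close> amounts to \<open>dim Y\<close> linear conditions, so
  imposing it on \<open>V\<close> costs at most that many dimensions.\<close>

lemma dim_le_dim_orthogonal_part:
  fixes V Y :: "'a::euclidean_space set"
  assumes "subspace V" "subspace Y"
  shows "dim V \<le> dim (V \<inter> {x. \<forall>y\<in>Y. orthogonal y x}) + dim Y"
proof -
  let ?C = "{x. \<forall>y\<in>Y. orthogonal y x}"
  have "subspace ?C"
    using subspace_orthogonal_to_vectors[of Y] by (simp add: orthogonal_commute)
  moreover have "dim ?C + dim Y = DIM('a)"
    using dim_subspace_orthogonal_to_vectors[of Y UNIV] assms by simp
  ultimately show ?thesis
    using dim_sums_Int[OF assms(1), of ?C] dim_subset_UNIV[of "{x + y |x y. x \<in> V \<and> y \<in> ?C}"]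
    by linarith
qed

text \<open>Replaces a spectral decomposition when only dimensions matter. \<open>U\<close> is a
  subspace of maximal dimension on which the form is nonnegative, and \<open>W\<close> is the part
  of \<open>V\<close> orthogonal to the image of \<open>U\<close> under \<open>A\<close>. The two
  may overlap.\<close>

lemma self_adjoint_form_split:
  fixes A :: "'a::euclidean_space \<Rightarrow> 'a"
  assumes "linear A" and self_adjoint: "\<And>x y. x \<bullet> A y = A x \<bullet> y" and V: "subspace V"
  obtains U W where "subspace U" "U \<subseteq> V" "\<And>u. u \<in> U \<Longrightarrow> 0 \<le> u \<bullet> A u"
    "subspace W" "W \<subseteq> V" "\<And>w. w \<in> W \<Longrightarrow> w \<bullet> A w \<le> 0" "dim V \<le> dim U + dim W"
proof -
  interpret A: linear A by fact
  let ?P = "\<lambda>U. subspace U \<and> U \<subseteq> V \<and> (\<forall>u\<in>U. 0 \<le> u \<bullet> A u)"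
  have "?P {0}"
    using V by (auto simp: subspace_0)
  moreover have "\<forall>U. ?P U \<longrightarrow> dim U \<le> dim V"
    by (auto intro: dim_subset)
  ultimately obtain U where U: "?P U" and max: "\<And>U'. ?P U' \<Longrightarrow> dim U' \<le> dim U"
    using Lattices_Big.ex_has_greatest_nat[of ?P "{0}" dim "Suc (dim V)"]
    by (metis (no_types, lifting) le_imp_less_Suc)
  \<comment> \<open>If the form were positive at some \<open>w\<close> that is orthogonal to \<open>U\<close> with respect to it,
    then \<open>U\<close> could be enlarged by \<open>w\<close>.\<close>
  define W where "W = V \<inter> {x. \<forall>y\<in>A ` U. orthogonal y x}"
  have sW: "subspace W"
    unfolding W_def using V subspace_orthogonal_to_vectors[of "A ` U"]
    by (intro subspace_inter) (simp_all add: orthogonal_commute)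
  have AU: "subspace (A ` U)"
    using U linear_subspace_image[OF \<open>linear A\<close>] by blast
  have "dim (A ` U) \<le> dim U"
    using dim_image_le[OF \<open>linear A\<close>] .
  then have dims: "dim V \<le> dim U + dim W"
    using dim_le_dim_orthogonal_part[OF V AU] unfolding W_def by linarith
  have nonpos: "w \<bullet> A w \<le> 0" if w: "w \<in> W" for w
  proof (rule ccontr)
    assume pos: "\<not> w \<bullet> A w \<le> 0"
    have ortho: "A u \<bullet> w = 0" "u \<bullet> A w = 0" "w \<bullet> A u = 0" if "u \<in> U" for u
    proof -
      show *: "A u \<bullet> w = 0"
        using w that unfolding W_def by (auto simp: orthogonal_def)
      then show "u \<bullet> A w = 0" "w \<bullet> A u = 0"
        using self_adjoint[of u w] inner_commute[of w "A u"] by simp_all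
    qed
    have "w \<notin> U"
      using ortho pos by auto
    have wV: "w \<in> V" using w unfolding W_def by auto
    define U' where "U' = span (insert w U)"
    have "0 \<le> x \<bullet> A x" if x: "x \<in> U'" for x
    proof -
      from x obtain c where "x - c *\<^sub>R w \<in> span U"
        unfolding U'_def by (auto simp: span_insert)
      moreover define u where "u = x - c *\<^sub>R w"
      ultimately have u: "u \<in> U" and x_eq: "x = u + c *\<^sub>R w"
        using U by (auto simp: span_eq_iff[THEN iffD2])
      have "x \<bullet> A x = u \<bullet> A u + c\<^sup>2 * (w \<bullet> A w)"
        using ortho[OF u] unfolding x_eq
        by (simp add: A.add A.scaleR inner_add_left inner_add_right power2_eq_square)
      then show ?thesis
        using U u pos by auto
    qed
    moreover have "U' \<subseteq> V"
      unfolding U'_def using U wV V by (simp add: span_minimal)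
    ultimately have "dim U' \<le> dim U"
      using max[of U'] unfolding U'_def by auto
    moreover have "dim U' = Suc (dim U)"
      unfolding U'_def using \<open>w \<notin> U\<close> U by (simp add: dim_insert span_eq_iff[THEN iffD2])
    ultimately show False by simp
  qed
  show ?thesis
    using that[of U W] U sW nonpos dims unfolding W_def by blast
qed

lemma dim_Int_ge:
  fixes V X Y :: "'a::euclidean_space set"
  assumes "subspace X" "subspace Y" "X \<subseteq> V" "Y \<subseteq> V" "subspace V"
  shows "dim X + dim Y \<le> dim (X \<inter> Y) + dim V"
proof -
  have "{x + y |x y. x \<in> X \<and> y \<in> Y} \<subseteq> V"
    using assms by (auto intro: subspace_add)
  from dim_subset[OF this] show ?thesis
    using dim_sums_Int[OF assms(1,2)] by linarith
qed

text \<open>A dimension-counting pigeonhole. If no \<open>j\<close> had a large subspace where it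
  carries the fraction \<open>t\<close>, then for each \<open>j\<close> the reverse inequality would
  hold on a subspace of codimension at most \<open>k\<close>. These subspaces have a common nonzero
  vector, on which the forms sum to less than the whole.\<close>

lemma dominant_component:
  fixes R :: "'j \<Rightarrow> 'a::euclidean_space \<Rightarrow> 'a"
  assumes lin: "\<And>j. linear (R j)" and self_adjoint: "\<And>j x y. x \<bullet> R j y = R j x \<bullet> y"
    and V: "subspace V" and J: "finite J"
    and total: "\<And>v. v \<in> V \<Longrightarrow> (\<Sum>j\<in>J. v \<bullet> R j v) = v \<bullet> v"
    and t: "t * real (card J) < 1" and dim: "card J * k < dim V"
  obtains j U where "j \<in> J" "subspace U" "U \<subseteq> V" "k < dim U"
    "\<And>u. u \<in> U \<Longrightarrow> t * (u \<bullet> u) \<le> u \<bullet> R j u"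
proof (rule ccontr)
  note witness = that
  assume not: "\<not> thesis"
  have "\<exists>W. subspace W \<and> W \<subseteq> V \<and> (\<forall>w\<in>W. w \<bullet> R j w \<le> t * (w \<bullet> w)) \<and> dim V \<le> k + dim W"
    if "j \<in> J" for j
  proof -
    \<comment> \<open>Subtracting \<open>t\<close> times the identity turns the comparison with
      \<open>t * (v \<bullet> v)\<close> into a question of sign.\<close>
    let ?A = "\<lambda>x. R j x - t *\<^sub>R x"
    have "linear ?A"
      by (intro linear_compose_sub lin linear_compose_scale_right linear_ident)
    moreover have "x \<bullet> ?A y = ?A x \<bullet> y" for x y
      by (simp add: inner_diff_left inner_diff_right self_adjoint)
    ultimately obtain U W where UW: "subspace U" "U \<subseteq> V" "\<And>u. u \<in> U \<Longrightarrow> 0 \<le> u \<bullet> ?A u"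
      "subspace W" "W \<subseteq> V" "\<And>w. w \<in> W \<Longrightarrow> w \<bullet> ?A w \<le> 0" "dim V \<le> dim U + dim W"
      using self_adjoint_form_split[OF _ _ V] by blast
    have "\<not> k < dim U"
      using witness[of j U] not UW(1-3) \<open>j \<in> J\<close> by (auto simp: inner_diff_right)
    then show ?thesis
      using UW(4-7) by (intro exI[of _ W]) (auto simp: inner_diff_right)
  qed
  then obtain W where W: "\<And>j. j \<in> J \<Longrightarrow> subspace (W j)" "\<And>j. j \<in> J \<Longrightarrow> W j \<subseteq> V"
    "\<And>j w. j \<in> J \<Longrightarrow> w \<in> W j \<Longrightarrow> w \<bullet> R j w \<le> t * (w \<bullet> w)" "\<And>j. j \<in> J \<Longrightarrow> dim V \<le> k + dim (W j)"
    by metis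
  \<comment> \<open>Codimensions in \<open>V\<close> add up at most: each further \<open>W j\<close>
    costs at most \<open>k\<close>.\<close>
  have "subspace (V \<inter> (\<Inter>j\<in>J'. W j)) \<and> dim V \<le> card J' * k + dim (V \<inter> (\<Inter>j\<in>J'. W j))"
    if "J' \<subseteq> J" for J'
    using finite_subset[OF that J] that
  proof (induction J' rule: finite_induct)
    case empty
    then show ?case using V by simp
  next
    case (insert j J')
    let ?X = "V \<inter> (\<Inter>j\<in>J'. W j)"
    have eq: "V \<inter> (\<Inter>j\<in>insert j J'. W j) = ?X \<inter> W j" by auto
    have "dim ?X + dim (W j) \<le> dim (?X \<inter> W j) + dim V"
      using insert V W(1,2)[of j] by (intro dim_Int_ge) auto
    moreover have "subspace (?X \<inter> W j)"
      using subspace_inter[of ?X "W j"] insert W(1)[of j] by auto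
    ultimately show ?case
      using insert W(4)[of j] unfolding eq by auto
  qed
  from this[of J] have "0 < dim (V \<inter> (\<Inter>j\<in>J. W j))"
    using dim by auto
  then have "\<not> V \<inter> (\<Inter>j\<in>J. W j) \<subseteq> {0}"
    using dim_eq_0[of "V \<inter> (\<Inter>j\<in>J. W j)"] by linarith
  then obtain v where v: "v \<in> V" "\<And>j. j \<in> J \<Longrightarrow> v \<in> W j" "v \<noteq> 0"
    by auto
  have "v \<bullet> v = (\<Sum>j\<in>J. v \<bullet> R j v)"
    using total v by simp
  also have "\<dots> \<le> (\<Sum>j\<in>J. t * (v \<bullet> v))"
    using W(3) v by (intro sum_mono) auto
  also have "\<dots> = (t * real (card J)) * (v \<bullet> v)"
    by simp
  also have "\<dots> < 1 * (v \<bullet> v)"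
    using t v by (intro mult_strict_right_mono) auto
  finally show False by simp
qed

subsection \<open>Triangular systems of linear forms\<close>

text \<open>The smallest index \<open>b\<close> is split off: no event with a larger index depends
  on the coordinate \<open>p b\<close>. Integrating that coordinate first leaves the other events
  fixed and yields one factor \<open>q\<close>.\<close>

lemma (in product_prob_space) emeasure_triangular_events_le:
  fixes E :: "nat \<Rightarrow> ('i \<Rightarrow> 'a) \<Rightarrow> bool"
  assumes A: "finite A" and J: "finite J"
    and meas: "\<And>i. i \<in> J \<Longrightarrow> {f \<in> space (PiM A M). E i f} \<in> sets (PiM A M)"
    and pivot: "\<And>i. i \<in> J \<Longrightarrow> p i \<in> A"
    and irrelevant: "\<And>i i' f v. i \<in> J \<Longrightarrow> i' \<in> J \<Longrightarrow> i' < i \<Longrightarrow> E i (f(p i' := v)) = E i f"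
    and prob: "\<And>i f. i \<in> J \<Longrightarrow> f \<in> space (PiM (A - {p i}) M) \<Longrightarrow>
      emeasure (M (p i)) {v \<in> space (M (p i)). E i (f(p i := v))} \<le> q"
  shows "emeasure (PiM A M) {f \<in> space (PiM A M). \<forall>i\<in>J. E i f} \<le> q ^ card J"
  using J meas pivot irrelevant prob
proof (induction J rule: finite_linorder_min_induct)
  case empty
  interpret A: prob_space "PiM A M" by (intro prob_space_PiM prob_space)
  show ?case by (simp add: A.emeasure_space_1)
next
  case (insert b J)
  let ?p = "p b" and ?A = "A - {p b}"
  let ?S = "{f \<in> space (PiM A M). \<forall>i\<in>insert b J. E i f}"
  let ?R = "{f \<in> space (PiM A M). \<forall>i\<in>J. E i f}"
  have A_eq: "insert ?p ?A = A" using insert.prems(2) by auto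
  have S[measurable]: "?S \<in> sets (PiM A M)" and R[measurable]: "?R \<in> sets (PiM A M)"
    using insert.prems(1) insert.hyps(1) by (auto intro!: sets.sets_Collect_finite_All')
  \<comment> \<open>Fubini, with the pivot coordinate of \<open>b\<close> innermost.\<close>
  have *: "emeasure (PiM A M) X = (\<integral>\<^sup>+ f. \<integral>\<^sup>+ v. indicator X (f(?p := v)) \<partial>M ?p \<partial>PiM ?A M)"
    if "X \<in> sets (PiM A M)" for X
    using product_nn_integral_insert[of ?A ?p "indicator X"] A that unfolding A_eq
    by (simp add: nn_integral_indicator)
  have le: "(\<integral>\<^sup>+ v. indicator ?S (f(?p := v)) \<partial>M ?p) \<le> q * (\<integral>\<^sup>+ v. indicator ?R (f(?p := v)) \<partial>M ?p)"
    if f: "f \<in> space (PiM ?A M)" for f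
  proof -
    have sp: "f(?p := v) \<in> space (PiM A M)" if "v \<in> space (M ?p)" for v
      using f that PiE_fun_upd[of v "\<lambda>i. space (M i)" ?p f ?A] unfolding A_eq space_PiM by auto
    have same: "E i (f(?p := v)) = E i f" if "i \<in> J" for i v
      using insert.hyps that by (intro insert.prems(3)) auto
    show ?thesis
    \<comment> \<open>The events in \<open>J\<close> are already decided by \<open>f\<close>,
      whatever \<open>v\<close> is. If they hold, only \<open>E b\<close> is left to bound;
      otherwise the left side is zero.\<close>
    proof (cases "\<forall>i\<in>J. E i f")
      case True
      have B: "{v \<in> space (M ?p). E b (f(?p := v))} = (\<lambda>v. f(?p := v)) -` ?S \<inter> space (M ?p)"
        using sp same True by auto
      have "(\<lambda>v. f(?p := v)) \<in> measurable (M ?p) (PiM (insert ?p ?A) M)"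
        using f by (intro measurable_fun_upd[where J = ?A]) auto
      then have "{v \<in> space (M ?p). E b (f(?p := v))} \<in> sets (M ?p)"
        unfolding B A_eq using S by (rule measurable_sets)
      then have "emeasure (M ?p) {v \<in> space (M ?p). E b (f(?p := v))}
          = (\<integral>\<^sup>+ v. indicator {v \<in> space (M ?p). E b (f(?p := v))} v \<partial>M ?p)"
        by simp
      also have "\<dots> = (\<integral>\<^sup>+ v. indicator ?S (f(?p := v)) \<partial>M ?p)"
        using sp same True by (intro nn_integral_cong) (auto simp: indicator_def)
      finally have "emeasure (M ?p) {v \<in> space (M ?p). E b (f(?p := v))} = \<dots>" .
      moreover have "emeasure (M ?p) {v \<in> space (M ?p). E b (f(?p := v))} \<le> q"
        using f by (intro insert.prems(4)) auto
      ultimately have "(\<integral>\<^sup>+ v. indicator ?S (f(?p := v)) \<partial>M ?p) \<le> q"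
        by (simp only:)
      moreover have "(\<integral>\<^sup>+ v. indicator ?R (f(?p := v)) \<partial>M ?p) = (\<integral>\<^sup>+ v. 1 \<partial>M ?p)"
        using sp same True by (intro nn_integral_cong) (auto simp: indicator_def)
      ultimately show ?thesis by (simp add: M.emeasure_space_1)
    next
      case False
      then have "(\<integral>\<^sup>+ v. indicator ?S (f(?p := v)) \<partial>M ?p) = (\<integral>\<^sup>+ v. 0 \<partial>M ?p)"
        using same by (intro nn_integral_cong) (auto simp: indicator_def)
      then show ?thesis by simp
    qed
  qed
  have "emeasure (PiM A M) ?S = (\<integral>\<^sup>+ f. \<integral>\<^sup>+ v. indicator ?S (f(?p := v)) \<partial>M ?p \<partial>PiM ?A M)"
    using *[OF S] .
  also have "\<dots> \<le> (\<integral>\<^sup>+ f. q * (\<integral>\<^sup>+ v. indicator ?R (f(?p := v)) \<partial>M ?p) \<partial>PiM ?A M)"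
    by (intro nn_integral_mono le)
  also have "\<dots> = q * (\<integral>\<^sup>+ f. \<integral>\<^sup>+ v. indicator ?R (f(?p := v)) \<partial>M ?p \<partial>PiM ?A M)"
  proof (rule nn_integral_cmult)
    have [measurable]: "?R \<in> sets (PiM (insert ?p ?A) M)" unfolding A_eq by (rule R)
    have [measurable]: "(\<lambda>x. (fst x)(?p := snd x)) \<in> measurable (PiM ?A M \<Otimes>\<^sub>M M ?p) (PiM (insert ?p ?A) M)"
      by (intro measurable_fun_upd[where J = ?A]) auto
    have "(\<lambda>(f, v). indicator ?R (f(?p := v)) :: ennreal) \<in> borel_measurable (PiM ?A M \<Otimes>\<^sub>M M ?p)"
      unfolding split_beta' by measurable
    then show "(\<lambda>f. \<integral>\<^sup>+ v. indicator ?R (f(?p := v)) \<partial>M ?p) \<in> borel_measurable (PiM ?A M)"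
      by (rule sigma_finite_measure.borel_measurable_nn_integral[OF sigma_finite_measures])
  qed
  also have "\<dots> = q * emeasure (PiM A M) ?R"
    using *[OF R] by simp
  also have "\<dots> \<le> q * q ^ card J"
    using insert by (intro mult_left_mono insert.IH) auto
  also have "\<dots> = q ^ card (insert b J)"
    using insert.hyps by (subst card_insert_disjoint) auto
  finally show ?case .
qed

section \<open>Anti-concentration of Gaussian vectors\<close>

lemma emeasure_normal_strip_le:
  assumes "0 < \<sigma>" "0 < \<gamma>" "\<gamma> \<le> \<bar>c\<bar>" "0 < \<epsilon>"
  shows "emeasure (density lborel (normal_density 0 \<sigma>)) {v. \<bar>b + c * v\<bar> < \<epsilon>}
    \<le> ennreal (sqrt (2 / pi) / \<sigma> * \<epsilon> / \<gamma>)"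
proof -
  \<comment> \<open>\<open>?d\<close> is the maximum of the density and \<open>?I\<close> an
    interval of length \<open>2 * \<epsilon> / \<gamma>\<close> around the zero of the affine form;
    the bound is their product and is uniform in \<open>b\<close>.\<close>
  let ?d = "1 / sqrt (2 * pi * \<sigma>\<^sup>2)" and ?I = "{- b / c - \<epsilon> / \<gamma>..- b / c + \<epsilon> / \<gamma>}"
  have c: "c \<noteq> 0" using assms by auto
  have sub: "{v. \<bar>b + c * v\<bar> < \<epsilon>} \<subseteq> ?I"
  proof
    fix v assume v: "v \<in> {v. \<bar>b + c * v\<bar> < \<epsilon>}"
    have "\<gamma> * \<bar>v + b / c\<bar> \<le> \<bar>c\<bar> * \<bar>v + b / c\<bar>"
      using assms by (intro mult_right_mono) auto
    also have "\<dots> = \<bar>b + c * v\<bar>"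
    proof -
      have "b + c * v = c * (v + b / c)"
        using c by (simp add: field_simps)
      then show ?thesis by (simp add: abs_mult)
    qed
    finally have "\<gamma> * \<bar>v + b / c\<bar> \<le> \<epsilon>" using v by simp
    then have "\<bar>v + b / c\<bar> \<le> \<epsilon> / \<gamma>"
      using assms by (simp add: field_simps)
    then show "v \<in> ?I" by (simp add: abs_le_iff)
  qed
  have dens: "normal_density 0 \<sigma> v \<le> ?d" for v
    unfolding normal_density_def using mult_left_mono[of "exp (- (v - 0)\<^sup>2 / (2 * \<sigma>\<^sup>2))" 1 ?d] by simp
  have "emeasure (density lborel (normal_density 0 \<sigma>)) {v. \<bar>b + c * v\<bar> < \<epsilon>}
      \<le> emeasure (density lborel (normal_density 0 \<sigma>)) ?I"
    by (intro emeasure_mono sub) auto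
  also have "\<dots> = (\<integral>\<^sup>+ v. ennreal (normal_density 0 \<sigma> v) * indicator ?I v \<partial>lborel)"
    by (intro emeasure_density) auto
  also have "\<dots> \<le> (\<integral>\<^sup>+ v. ennreal ?d * indicator ?I v \<partial>lborel)"
    by (intro nn_integral_mono mult_right_mono ennreal_leI dens) auto
  also have "\<dots> = ennreal ?d * ennreal (2 * \<epsilon> / \<gamma>)"
    using assms by (simp add: nn_integral_cmult_indicator)
  also have "\<dots> = ennreal (?d * (2 * \<epsilon> / \<gamma>))"
    using assms by (intro ennreal_mult[symmetric]) auto
  also have "?d * 2 = sqrt (2 / pi) / \<sigma>"
  proof -
    have "2 = sqrt 2 * sqrt (2::real)" by simp
    then show ?thesis
      using assms by (simp add: real_sqrt_mult real_sqrt_divide field_simps)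
  qed
  then have "?d * (2 * \<epsilon> / \<gamma>) = sqrt (2 / pi) / \<sigma> * \<epsilon> / \<gamma>"
    by (metis (no_types, lifting) mult.assoc times_divide_eq_right)
  finally show ?thesis .
qed

text \<open>Isolates the property of the perturbed vectors on which the induction over modes rests.
  For a single form with pivot at least \<open>\<gamma>\<close> it gives
  \<open>\<kappa> * \<epsilon> / \<gamma>\<close>; a triangular system gains one such factor per
  form.\<close>

definition anti_concentrated :: "real \<Rightarrow> (real ^ 'n::finite) measure \<Rightarrow> bool" where
  "anti_concentrated \<kappa> N \<longleftrightarrow> prob_space N \<and> sets N = sets borel \<and>
    (\<forall>(I :: nat set) p c \<epsilon> \<gamma>. finite I \<longrightarrow> 0 < \<epsilon> \<longrightarrow> 0 < \<gamma> \<longrightarrow> (\<forall>i\<in>I. \<gamma> \<le> \<bar>c i $ p i\<bar>) \<longrightarrow>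
      (\<forall>i\<in>I. \<forall>i'\<in>I. i' < i \<longrightarrow> c i $ p i' = 0) \<longrightarrow>
      measure N {z. \<forall>i\<in>I. \<bar>c i \<bullet> z\<bar> < \<epsilon>} \<le> (\<kappa> * \<epsilon> / \<gamma>) ^ card I)"

text \<open>The noise has a product law, so the triangular bound applies to it; the centre
  \<open>x\<close> only adds a constant to each form. The constant is \<open>sqrt (2 / pi)\<close>
  divided by the standard deviation of a coordinate, which is twice the maximal density.\<close>

lemma rho_perturbation_anti_concentrated:
  fixes X :: "'w \<Rightarrow> real ^ 'n::finite"
  assumes "prob_space M" and \<rho>: "0 < \<rho>" and pert: "rho_perturbation M \<rho> x X"
    and X[measurable]: "X \<in> borel_measurable M"
  shows "anti_concentrated (sqrt (2 / pi) * sqrt (real CARD('n)) / \<rho>) (distr M borel X)"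
proof -
  interpret prob_space M by fact
  define \<sigma> where "\<sigma> = \<rho> / sqrt (real CARD('n))"
  have \<sigma>: "0 < \<sigma>" using \<rho> by (simp add: \<sigma>_def)
  let ?G = "density lborel (normal_density 0 \<sigma>)"
  let ?g = "\<lambda>i \<omega>. (X \<omega> - x) $ i"
  have g[measurable]: "?g i \<in> borel_measurable M" for i
    using pert unfolding rho_perturbation_def indep_vars_def by auto
  interpret G: product_prob_space "\<lambda>_::'n. ?G"
    by (intro product_prob_spaceI prob_space_normal_density \<sigma>)
  have "distr M borel (?g i) = ?G" for i
  proof -
    have "distr M borel (?g i) = distr M lborel (?g i)"
      by (intro distr_cong) auto
    then show ?thesis
      using pert distributed_distr_eq_density unfolding rho_perturbation_def \<sigma>_def by metis
  qed
  moreover have "indep_vars (\<lambda>_. borel) ?g UNIV"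
    using pert unfolding rho_perturbation_def by blast
  ultimately have law: "distr M (\<Pi>\<^sub>M i\<in>UNIV. borel) (\<lambda>\<omega>. \<lambda>i\<in>UNIV. ?g i \<omega>) = (\<Pi>\<^sub>M i\<in>UNIV. ?G)"
    using indep_vars_iff_distr_eq_PiM[where I = UNIV and M' = "\<lambda>_. borel" and X = ?g] g by simp
  have "measure (distr M borel X) {z. \<forall>i\<in>I. \<bar>c i \<bullet> z\<bar> < \<epsilon>}
      \<le> (sqrt (2 / pi) / \<sigma> * \<epsilon> / \<gamma>) ^ card I"
    if I: "finite I" and \<epsilon>: "0 < \<epsilon>" and \<gamma>: "0 < \<gamma>" and piv: "\<forall>i\<in>I. \<gamma> \<le> \<bar>c i $ p i\<bar>"
      and tri: "\<forall>i\<in>I. \<forall>i'\<in>I. i' < i \<longrightarrow> c i $ p i' = 0"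
    for I :: "nat set" and p :: "nat \<Rightarrow> 'n" and c \<epsilon> \<gamma>
  proof -
    define E where "E i f \<longleftrightarrow> \<bar>c i \<bullet> x + (\<Sum>j\<in>UNIV. c i $ j * f j)\<bar> < \<epsilon>" for i and f :: "'n \<Rightarrow> real"
    have E_X: "\<bar>c i \<bullet> X \<omega>\<bar> < \<epsilon> \<longleftrightarrow> E i (\<lambda>j\<in>UNIV. ?g j \<omega>)" for i \<omega>
    proof -
      have "c i \<bullet> X \<omega> = c i \<bullet> x + c i \<bullet> (X \<omega> - x)"
        by (simp add: inner_diff_right)
      then show ?thesis
        unfolding E_def by (simp add: inner_vec_def)
    qed
    have meas: "{f \<in> space (\<Pi>\<^sub>M i\<in>UNIV. ?G). E i f} \<in> sets (\<Pi>\<^sub>M i\<in>UNIV. ?G)" for i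
    proof -
      have "(\<lambda>f. f j) \<in> borel_measurable (\<Pi>\<^sub>M i\<in>UNIV. ?G)" for j :: 'n
        using measurable_component_singleton[of j UNIV "\<lambda>_. ?G"] by simp
      then show ?thesis unfolding E_def by measurable
    qed
    then have meas': "{f \<in> space (\<Pi>\<^sub>M i\<in>UNIV. ?G). \<forall>i\<in>I. E i f} \<in> sets (\<Pi>\<^sub>M i\<in>UNIV. ?G)"
      using I by (intro sets.sets_Collect_finite_All) auto
    have "{z. \<forall>i\<in>I. \<bar>c i \<bullet> z\<bar> < \<epsilon>} \<in> sets borel"
      using I by measurable
    then have "emeasure (distr M borel X) {z. \<forall>i\<in>I. \<bar>c i \<bullet> z\<bar> < \<epsilon>}
        = emeasure M {\<omega> \<in> space M. \<forall>i\<in>I. E i (\<lambda>j\<in>UNIV. ?g j \<omega>)}"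
      by (subst emeasure_distr) (auto simp flip: E_X intro!: arg_cong[where f = "emeasure M"])
    also have "\<dots> = emeasure (\<Pi>\<^sub>M i\<in>UNIV. ?G) {f \<in> space (\<Pi>\<^sub>M i\<in>UNIV. ?G). \<forall>i\<in>I. E i f}"
      unfolding law[symmetric]
      using meas' unfolding law[symmetric]
      by (subst emeasure_distr)
        (auto simp: space_PiM intro!: arg_cong[where f = "emeasure M"])
    also have "\<dots> \<le> ennreal (sqrt (2 / pi) / \<sigma> * \<epsilon> / \<gamma>) ^ card I"
    proof (rule G.emeasure_triangular_events_le[where p = p])
      fix i i' f v assume "i \<in> I" "i' \<in> I" "i' < i"
      then have "c i $ j * (f(p i' := v)) j = c i $ j * f j" for j
        using tri by auto
      then show "E i (f(p i' := v)) = E i f"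
        unfolding E_def by presburger
    next
      \<comment> \<open>With all coordinates but \<open>p i\<close> frozen, the form is affine in
        \<open>v\<close> with slope \<open>c i $ p i\<close>.\<close>
      fix i and f :: "'n \<Rightarrow> real" assume i: "i \<in> I"
      have "(\<Sum>j\<in>UNIV. c i $ j * (f(p i := v)) j)
          = c i $ p i * v + (\<Sum>j\<in>UNIV - {p i}. c i $ j * f j)" for v
        by (subst sum.remove[of _ "p i"]) (auto intro!: sum.cong)
      then have "{v \<in> space ?G. E i (f(p i := v))}
          = {v. \<bar>(c i \<bullet> x + (\<Sum>j\<in>UNIV - {p i}. c i $ j * f j)) + c i $ p i * v\<bar> < \<epsilon>}"
        unfolding E_def by (simp add: algebra_simps)
      then show "emeasure ?G {v \<in> space ?G. E i (f(p i := v))} \<le> ennreal (sqrt (2 / pi) / \<sigma> * \<epsilon> / \<gamma>)"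
        using emeasure_normal_strip_le[OF \<sigma> \<gamma> _ \<epsilon>, of "c i $ p i"] piv i by simp
    qed (use I meas in auto)
    also have "\<dots> = ennreal ((sqrt (2 / pi) / \<sigma> * \<epsilon> / \<gamma>) ^ card I)"
      using \<epsilon> \<gamma> \<sigma> by (intro ennreal_power) auto
    finally show ?thesis
      using \<epsilon> \<gamma> \<sigma> unfolding measure_def by (intro enn2real_leI) auto
  qed
  then show ?thesis
    unfolding anti_concentrated_def \<sigma>_def by (auto simp: prob_space_distr mult_ac)
qed

subsection \<open>Slices of tensors\<close>

text \<open>
  Tensors with modes in \<open>K\<close> stay in the full tensor type: they are supported on the extensional
  multi-indices, which take the value \<^const>\<open>undefined\<close> outside \<open>K\<close>.
\<close>

definition tensors_on :: "'l set \<Rightarrow> ('l::finite, 'n::finite) tensor set" where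
  "tensors_on K = {T. \<forall>i. i \<notin> PiE K (\<lambda>_. UNIV) \<longrightarrow> T $ i = 0}"

definition contraction_on :: "'l set \<Rightarrow> ('l::finite, 'n::finite) tensor \<Rightarrow> ('l \<Rightarrow> real ^ 'n) \<Rightarrow> real" where
  "contraction_on K T y = (\<Sum>i\<in>PiE K (\<lambda>_. UNIV). T $ i * (\<Prod>k\<in>K. y k $ i k))"

definition slice :: "'l set \<Rightarrow> 'l \<Rightarrow> 'n \<Rightarrow> ('l::finite, 'n::finite) tensor \<Rightarrow> ('l, 'n) tensor" where
  "slice K k j T = (\<chi> i. if i \<in> PiE K (\<lambda>_. UNIV) then T $ (i(k := j)) else 0)"

text \<open>The slice at \<open>j\<close>, left in its place. This makes it an orthogonal projection
  of the tensor space, to which the results on quadratic forms apply, whereas \<open>slice\<close>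
  drops the mode \<open>k\<close>.\<close>

definition restrict_mode :: "'l \<Rightarrow> 'n \<Rightarrow> ('l::finite, 'n::finite) tensor \<Rightarrow> ('l, 'n) tensor" where
  "restrict_mode k j T = (\<chi> i. if i k = j then T $ i else 0)"

lemma linear_slice: "linear (slice K k j)"
  by (intro linearI) (auto simp: slice_def vec_eq_iff)

lemma slice_in_tensors_on: "slice K k j T \<in> tensors_on K"
  by (simp add: slice_def tensors_on_def)

lemma linear_restrict_mode: "linear (restrict_mode k j)"
  by (intro linearI) (auto simp: restrict_mode_def vec_eq_iff)

lemma restrict_mode_self_adjoint: "S \<bullet> restrict_mode k j T = restrict_mode k j S \<bullet> T"
  by (auto simp: restrict_mode_def inner_vec_def intro!: sum.cong)

lemma sum_restrict_mode: "(\<Sum>j\<in>UNIV. T \<bullet> restrict_mode k j T) = T \<bullet> T"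
proof -
  have "(\<Sum>j\<in>UNIV. T \<bullet> restrict_mode k j T) = (\<Sum>i\<in>UNIV. \<Sum>j\<in>UNIV. if i k = j then T $ i * T $ i else 0)"
    unfolding restrict_mode_def inner_vec_def
    by (subst sum.swap) (auto intro!: sum.cong)
  then show ?thesis
    by (simp add: inner_vec_def)
qed

lemma slice_eq_0:
  assumes "restrict_mode k j T = 0"
  shows "slice K k j T = 0"
proof -
  have "T $ (i(k := j)) = 0" for i
    using arg_cong[OF assms, of "\<lambda>S. S $ (i(k := j))"] by (simp add: restrict_mode_def)
  then show ?thesis
    by (simp add: slice_def vec_eq_iff)
qed

lemma sum_PiE_insert:
  fixes g :: "('l::finite \<Rightarrow> 'n::finite) \<Rightarrow> real"
  assumes "k \<notin> K"
  shows "(\<Sum>i\<in>PiE (insert k K) (\<lambda>_. UNIV). g i) = (\<Sum>j\<in>UNIV. \<Sum>i\<in>PiE K (\<lambda>_. UNIV). g (i(k := j)))"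
proof -
  have "(\<Sum>i\<in>PiE (insert k K) (\<lambda>_. UNIV). g i) = (\<Sum>(j, i)\<in>UNIV \<times> PiE K (\<lambda>_. UNIV). g (i(k := j)))"
    unfolding PiE_insert_eq
    by (subst sum.reindex) (auto intro!: inj_combinator assms sum.cong)
  also have "\<dots> = (\<Sum>j\<in>UNIV. \<Sum>i\<in>PiE K (\<lambda>_. UNIV). g (i(k := j)))"
    by (rule sum.cartesian_product[symmetric])
  finally show ?thesis .
qed

text \<open>The link between consecutive modes: once the vectors of the modes in \<open>K\<close>
  are fixed, what remains is a linear form in \<open>y k\<close> whose coefficients come from the
  slices.\<close>

lemma contraction_on_insert:
  assumes "k \<notin> K"
  shows "contraction_on (insert k K) T y = (\<Sum>j\<in>UNIV. y k $ j * contraction_on K (slice K k j T) y)"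
proof -
  have "(\<Prod>l\<in>insert k K. y l $ (i(k := j)) l) = y k $ j * (\<Prod>l\<in>K. y l $ i l)" for i j
  proof -
    have "(\<Prod>l\<in>K. y l $ (i(k := j)) l) = (\<Prod>l\<in>K. y l $ i l)"
      using assms by (intro prod.cong) auto
    then show ?thesis using assms by simp
  qed
  then show ?thesis
    unfolding contraction_on_def sum_PiE_insert[OF assms]
    by (auto simp: slice_def sum_distrib_left mult_ac intro!: sum.cong)
qed

lemma inner_tensors_on:
  assumes "T \<in> tensors_on K"
  shows "T \<bullet> S = (\<Sum>i\<in>PiE K (\<lambda>_. UNIV). T $ i * S $ i)"
  unfolding inner_vec_def using assms
  by (intro sum.mono_neutral_cong_right) (auto simp: tensors_on_def)

lemma slice_inner_slice:
  assumes "k \<notin> K" "T \<in> tensors_on (insert k K)"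
  shows "slice K k j T \<bullet> slice K k j T = T \<bullet> restrict_mode k j T"
proof -
  have "T \<bullet> restrict_mode k j T
      = (\<Sum>j'\<in>UNIV. \<Sum>i\<in>PiE K (\<lambda>_. UNIV). if j' = j then (T $ (i(k := j)))\<^sup>2 else 0)"
    unfolding inner_tensors_on[OF assms(2)] sum_PiE_insert[OF assms(1)]
    by (intro sum.cong) (auto simp: restrict_mode_def power2_eq_square)
  also have "\<dots> = (\<Sum>i\<in>PiE K (\<lambda>_. UNIV). (T $ (i(k := j)))\<^sup>2)"
    by (subst sum.swap) simp
  also have "\<dots> = slice K k j T \<bullet> slice K k j T"
    unfolding inner_tensors_on[OF slice_in_tensors_on]
    by (intro sum.cong) (auto simp: slice_def power2_eq_square)
  finally show ?thesis by simp
qed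

lemma subspace_tensors_on: "subspace (tensors_on K)"
  by (auto simp: subspace_def tensors_on_def)

section \<open>Dimension lost by killing a slice, and the greedy choice of pivots\<close>

lemma dim_supported_le:
  fixes I :: "'i::finite set"
  shows "dim {x :: real ^ 'i. \<forall>i. i \<notin> I \<longrightarrow> x $ i = 0} \<le> card I"
proof -
  let ?B = "(\<lambda>i. axis i (1::real)) ` I"
  have "x \<in> span ?B" if "\<forall>i. i \<notin> I \<longrightarrow> x $ i = 0" for x :: "real ^ 'i"
  proof -
    have "x = (\<Sum>i\<in>I. x $ i *\<^sub>R axis i 1)"
      using that by (auto simp: vec_eq_iff axis_def if_distrib cong: if_cong)
    also have "\<dots> \<in> span ?B"
      by (intro span_sum span_scale span_base) auto
    finally show ?thesis .
  qed
  then have "dim {x :: real ^ 'i. \<forall>i. i \<notin> I \<longrightarrow> x $ i = 0} \<le> card ?B"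
    by (intro dim_le_card) auto
  also have "\<dots> \<le> card I"
    by (rule card_image_le) simp
  finally show ?thesis .
qed

text \<open>A slice has \<open>CARD('n) ^ card K\<close> entries, and making it vanish is
  orthogonality to the coordinate subspace of tensors supported on those entries.\<close>

lemma dim_restrict_mode_kernel:
  fixes V :: "('l::finite, 'n::finite) tensor set"
  assumes "k \<notin> K" "subspace V" "V \<subseteq> tensors_on (insert k K)"
  shows "dim V \<le> dim {T \<in> V. restrict_mode k j T = 0} + CARD('n) ^ card K"
proof -
  let ?I = "{i \<in> PiE (insert k K) (\<lambda>_. UNIV :: 'n set). i k = j}"
  let ?Y = "{x :: ('l, 'n) tensor. \<forall>i. i \<notin> ?I \<longrightarrow> x $ i = 0}"
  have "?I \<subseteq> (\<lambda>i. i(k := j)) ` PiE K (\<lambda>_. UNIV)"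
  proof
    fix i assume "i \<in> ?I"
    then have "i = (i(k := undefined))(k := j)" "i(k := undefined) \<in> PiE K (\<lambda>_. UNIV)"
      using assms(1) by (auto simp: PiE_def extensional_def)
    then show "i \<in> (\<lambda>i. i(k := j)) ` PiE K (\<lambda>_. UNIV)"
      by blast
  qed
  then have "card ?I \<le> card ((\<lambda>i. i(k := j)) ` PiE K (\<lambda>_. UNIV :: 'n set))"
    by (intro card_mono) auto
  also have "\<dots> \<le> card (PiE K (\<lambda>_. UNIV :: 'n set))"
    by (intro card_image_le) auto
  also have "\<dots> = CARD('n) ^ card K"
    by (intro card_funcsetE) auto
  finally have "dim ?Y \<le> CARD('n) ^ card K"
    using dim_supported_le[of ?I] by linarith
  moreover have "V \<inter> {x. \<forall>y\<in>?Y. orthogonal y x} \<subseteq> {T \<in> V. restrict_mode k j T = 0}"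
  proof
    fix T assume T: "T \<in> V \<inter> {x. \<forall>y\<in>?Y. orthogonal y x}"
    have "restrict_mode k j T \<in> ?Y"
      using T assms(3) by (auto simp: restrict_mode_def tensors_on_def)
    then have "restrict_mode k j T \<bullet> T = 0"
      using T by (auto simp: orthogonal_def)
    \<comment> \<open>A self-adjoint idempotent: orthogonality of the projection to \<open>T\<close>
      means that the projection has norm zero.\<close>
    moreover have "restrict_mode k j T = restrict_mode k j (restrict_mode k j T)"
      by (simp add: restrict_mode_def vec_eq_iff)
    ultimately have "restrict_mode k j T \<bullet> restrict_mode k j T = 0"
      using restrict_mode_self_adjoint by metis
    then show "T \<in> {T \<in> V. restrict_mode k j T = 0}"
      using T by simp
  qed
  then have "dim (V \<inter> {x. \<forall>y\<in>?Y. orthogonal y x}) \<le> dim {T \<in> V. restrict_mode k j T = 0}"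
    by (rule dim_subset)
  moreover have "subspace ?Y"
    unfolding subspace_def by simp
  ultimately show ?thesis
    using dim_le_dim_orthogonal_part[OF assms(2), of ?Y] by linarith
qed

text \<open>Greedy: take a dominant slice on a subspace of \<open>V\<close>, then continue inside
  the tensors of \<open>V\<close> whose slice there vanishes. Only \<open>s - 1\<close> such
  restrictions precede the last choice; the extra summand on the right of the dimension condition
  accounts for this without a subtraction.\<close>

lemma triangular_system:
  fixes V :: "('l::finite, 'n::finite) tensor set"
  assumes "k \<notin> K" "subspace V" "V \<subseteq> tensors_on (insert k K)"
    and t: "t * real CARD('n) < 1"
    and "s * CARD('n) ^ card K + CARD('n) * d < dim V + CARD('n) ^ card K"
  shows "\<exists>(p :: nat \<Rightarrow> 'n) U. \<forall>i<s. subspace (U i) \<and> U i \<subseteq> V \<and> d < dim (U i) \<and>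
    (\<forall>T\<in>U i. t * (T \<bullet> T) \<le> T \<bullet> restrict_mode k (p i) T) \<and>
    (\<forall>i'<i. \<forall>T\<in>U i. restrict_mode k (p i') T = 0)"
  using assms(2,3,5)
proof (induction s arbitrary: V)
  case 0
  then show ?case by simp
next
  case (Suc s)
  have "CARD('n) * d < dim V"
    using Suc.prems(3) by simp
  then obtain j U0 where U0: "subspace U0" "U0 \<subseteq> V" "d < dim U0"
    "\<And>T. T \<in> U0 \<Longrightarrow> t * (T \<bullet> T) \<le> T \<bullet> restrict_mode k j T"
    by (rule dominant_component[where R = "restrict_mode k" and J = UNIV, OF linear_restrict_mode
      restrict_mode_self_adjoint Suc.prems(1) finite sum_restrict_mode t])
      (rule that; assumption)
  define V' where "V' = {T \<in> V. restrict_mode k j T = 0}"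
  have sub: "subspace V'"
    using Suc.prems(1) linear_restrict_mode[of k j] unfolding V'_def subspace_def
    by (auto simp: linear_add linear_scale linear_0)
  have on: "V' \<subseteq> tensors_on (insert k K)"
    using Suc.prems(2) unfolding V'_def by auto
  have "dim V \<le> dim V' + CARD('n) ^ card K"
    unfolding V'_def by (rule dim_restrict_mode_kernel[OF assms(1) Suc.prems(1,2)])
  then have "s * CARD('n) ^ card K + CARD('n) * d < dim V' + CARD('n) ^ card K"
    using Suc.prems(3) by simp
  from Suc.IH[OF sub on this] obtain p U where "\<forall>i<s. subspace (U i) \<and> U i \<subseteq> V' \<and> d < dim (U i) \<and>
    (\<forall>T\<in>U i. t * (T \<bullet> T) \<le> T \<bullet> restrict_mode k (p i) T) \<and>
    (\<forall>i'<i. \<forall>T\<in>U i. restrict_mode k (p i') T = 0)"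
    by (elim exE)
  then have pU: "\<And>i. i < s \<Longrightarrow> subspace (U i)" "\<And>i. i < s \<Longrightarrow> U i \<subseteq> V'"
    "\<And>i. i < s \<Longrightarrow> d < dim (U i)"
    "\<And>i T. i < s \<Longrightarrow> T \<in> U i \<Longrightarrow> t * (T \<bullet> T) \<le> T \<bullet> restrict_mode k (p i) T"
    "\<And>i i' T. i < s \<Longrightarrow> i' < i \<Longrightarrow> T \<in> U i \<Longrightarrow> restrict_mode k (p i') T = 0"
    by auto
  have V': "U i \<subseteq> V" "T \<in> U i \<Longrightarrow> restrict_mode k j T = 0" if "i < s" for i T
    using pU(2)[OF that] unfolding V'_def by auto
  \<comment> \<open>The new pivot becomes index 0 and the others shift by one; all later subspaces
    lie in \<open>V'\<close>, where the slice at \<open>j\<close> is zero.\<close>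
  show ?case
    using U0 pU(1,3-5) V'
    by (intro exI[of _ "case_nat j p"] exI[of _ "case_nat U0 U"] allI impI)
      (auto split: nat.split simp: less_Suc_eq_0_disj intro: subsetD[OF V'(1)])
qed

subsection \<open>Small values of contractions\<close>

lemma anti_concentratedD:
  fixes I :: "nat set"
  assumes "anti_concentrated \<kappa> N" "finite I" "0 < \<epsilon>" "0 < \<gamma>" "\<And>i. i \<in> I \<Longrightarrow> \<gamma> \<le> \<bar>c i $ p i\<bar>"
    and "\<And>i i'. i \<in> I \<Longrightarrow> i' \<in> I \<Longrightarrow> i' < i \<Longrightarrow> c i $ p i' = 0"
  shows "measure N {z. \<forall>i\<in>I. \<bar>c i \<bullet> z\<bar> < \<epsilon>} \<le> (\<kappa> * \<epsilon> / \<gamma>) ^ card I"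
  using assms unfolding anti_concentrated_def by blast

lemma contraction_on_fun_upd:
  "k \<notin> K \<Longrightarrow> contraction_on K T (y(k := z)) = contraction_on K T y"
  unfolding contraction_on_def by (intro sum.cong refl arg_cong2[where f = "(*)"] prod.cong) auto

lemma contraction_on_0 [simp]: "contraction_on K 0 y = 0"
  by (simp add: contraction_on_def)

lemma contraction_on_scaleR: "contraction_on K (c *\<^sub>R T) y = c * contraction_on K T y"
  by (simp add: contraction_on_def sum_distrib_left mult.assoc)

lemma borel_measurable_contraction_on:
  fixes \<nu> :: "'l::finite \<Rightarrow> (real ^ 'n::finite) measure"
  assumes "\<And>k. sets (\<nu> k) = sets borel"
  shows "contraction_on K T \<in> borel_measurable (PiM K \<nu>)"
proof -
  have "(\<lambda>y. y k $ j) \<in> borel_measurable (PiM K \<nu>)" if "k \<in> K" for k j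
  proof -
    have "(\<lambda>y. y k) \<in> measurable (PiM K \<nu>) borel"
      using measurable_component_singleton[OF that, of \<nu>] assms measurable_cong_sets by blast
    moreover have "(\<lambda>x :: real ^ 'n. x $ j) \<in> borel_measurable borel"
      by (intro borel_measurable_continuous_onI continuous_intros)
    ultimately show ?thesis
      by (rule measurable_compose)
  qed
  then show ?thesis
    unfolding contraction_on_def by measurable
qed

text \<open>The chord bound for the convex function \<open>g \<mapsto> q ^ g\<close> on the interval
  from 0 to \<open>s\<close>, multiplied by \<open>s\<close>, with the weight \<open>g\<close> of
  \<open>q ^ s\<close> enlarged to \<open>s\<close>.\<close>

lemma power_convexity:
  fixes q :: real
  assumes "0 \<le> q" "q \<le> 1" "g \<le> s"
  shows "real s * q ^ g \<le> real (s - g) + real s * q ^ s"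
proof -
  define d where "d = s - g"
  have s: "s = g + d" using assms by (simp add: d_def)
  \<comment> \<open>\<open>1 - q ^ g\<close> is \<open>1 - q\<close> times a geometric sum of
    \<open>g\<close> terms, each at least \<open>q ^ g\<close>.\<close>
  have "real g * q ^ g * (1 - q) \<le> 1 - q ^ g"
  proof (induction g)
    case (Suc g)
    have "real (Suc g) * q ^ Suc g * (1 - q) \<le> real (Suc g) * q ^ g * (1 - q)"
      using assms by (intro mult_right_mono mult_left_mono power_decreasing) auto
    also have "\<dots> = real g * q ^ g * (1 - q) + q ^ g - q ^ Suc g"
      by (simp add: algebra_simps)
    finally show ?case using Suc by simp
  qed simp
  then have "real d * (real g * q ^ g * (1 - q)) \<le> real d * (1 - q ^ g)"
    by (intro mult_left_mono) auto
  moreover have "1 - q ^ d \<le> real d * (1 - q)"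
    using Bernoulli_inequality[of "q - 1" d] assms by (simp add: algebra_simps)
  then have "real g * q ^ g * (1 - q ^ d) \<le> real g * q ^ g * (real d * (1 - q))"
    using assms by (intro mult_left_mono) auto
  ultimately have "real g * q ^ g * (1 - q ^ d) \<le> real d * (1 - q ^ g)"
    by (simp add: mult_ac)
  then have "real s * q ^ g \<le> real d + real g * q ^ s"
    unfolding s by (simp add: algebra_simps power_add)
  also have "\<dots> \<le> real d + real s * q ^ s"
    unfolding s using assms by (intro add_left_mono mult_right_mono) auto
  finally show ?thesis by (simp add: d_def)
qed

text \<open>Here \<open>w\<close> is a tensor on \<open>K\<close> and \<open>S i w\<close> its lift
  to the modes \<open>insert k K\<close>. Condition on the modes in \<open>K\<close>: every index
  outside its bad event supplies a linear form in the last vector, these forms are triangular, and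
  the resulting power of \<open>q\<close> is averaged by convexity.\<close>

lemma contraction_small_ball_step:
  fixes \<nu> :: "'l::finite \<Rightarrow> (real ^ 'n::finite) measure" and S :: "nat \<Rightarrow> ('l, 'n) tensor \<Rightarrow> ('l, 'n) tensor"
  assumes k: "k \<notin> K" and t: "0 < t" and \<nu>: "\<And>k. anti_concentrated \<kappa> (\<nu> k)"
    and pos: "0 < \<kappa>" "0 < \<epsilon>" "0 < q" "q \<le> 1" and \<kappa>: "\<kappa> * \<epsilon> \<le> q * sqrt t" and s: "0 < s"
    and fin: "\<And>i. i < s \<Longrightarrow> finite (F i)"
    and zero: "\<And>i i' w. i < s \<Longrightarrow> i' < i \<Longrightarrow> w \<in> F i \<Longrightarrow> slice K k (p i') (S i w) = 0"
    and large: "\<And>i w y. i < s \<Longrightarrow> w \<in> F i \<Longrightarrow>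
      sqrt t * \<bar>contraction_on K w y\<bar> \<le> \<bar>contraction_on K (slice K k (p i) (S i w)) y\<bar>"
    and bad: "\<And>i. i < s \<Longrightarrow>
      measure (PiM K \<nu>) {y \<in> space (PiM K \<nu>). \<forall>w\<in>F i. \<bar>contraction_on K w y\<bar> < \<epsilon> ^ c} \<le> B"
  shows "measure (PiM (insert k K) \<nu>) {y \<in> space (PiM (insert k K) \<nu>).
    \<forall>i<s. \<forall>w\<in>F i. \<bar>contraction_on (insert k K) (S i w) y\<bar> < \<epsilon> ^ Suc c} \<le> B + q ^ s"
proof -
  have \<nu>_prob: "prob_space (\<nu> k)" and \<nu>_sets: "sets (\<nu> k) = sets borel" for k
    using \<nu> unfolding anti_concentrated_def by auto
  interpret product_prob_space \<nu>
    by (intro product_prob_spaceI \<nu>_prob)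
  let ?P = "PiM K \<nu>" and ?Q = "PiM (insert k K) \<nu>"
  interpret PK: prob_space ?P by (intro prob_space_PiM \<nu>_prob)
  note [measurable] = borel_measurable_contraction_on[OF \<nu>_sets]
  have small: "{y \<in> space (PiM K' \<nu>). \<bar>contraction_on K' T y\<bar> < e} \<in> sets (PiM K' \<nu>)" for K' T e
    by measurable
  define Bad where "Bad i = {y \<in> space ?P. \<forall>w\<in>F i. \<bar>contraction_on K w y\<bar> < \<epsilon> ^ c}" for i
  have Bad[measurable]: "Bad i \<in> sets ?P" if "i < s" for i
    unfolding Bad_def using fin[OF that] by (intro sets.sets_Collect_finite_All small)
  define Fail where "Fail = {y \<in> space ?Q.
    \<forall>i<s. \<forall>w\<in>F i. \<bar>contraction_on (insert k K) (S i w) y\<bar> < \<epsilon> ^ Suc c}"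
  have "Fail = {y \<in> space ?Q. \<forall>i\<in>{..<s}. \<forall>w\<in>F i.
      \<bar>contraction_on (insert k K) (S i w) y\<bar> < \<epsilon> ^ Suc c}"
    unfolding Fail_def by auto
  also have "\<dots> \<in> sets ?Q"
    using fin by (intro sets.sets_Collect_finite_All small) auto
  finally have Fail: "Fail \<in> sets ?Q" .
  \<comment> \<open>A pointwise bound linear in the indicators: its expectation involves only the
    individual probabilities of the bad events, however these depend on each other.\<close>
  define h where "h y = (\<Sum>i<s. indicator (Bad i) y + q ^ s) / real s" for y
  have slice_le: "(\<integral>\<^sup>+ z. indicator Fail (y(k := z)) \<partial>\<nu> k) \<le> ennreal (h y)" if y: "y \<in> space ?P" for y
  proof -
    define I where "I = {i. i < s \<and> y \<notin> Bad i}"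
    have I: "finite I" "I \<subseteq> {..<s}" by (auto simp: I_def)
    \<comment> \<open>For each good index one witness is picked; the choice may vary with
      \<open>y\<close>, which is fixed here.\<close>
    have "\<forall>i\<in>I. \<exists>w\<in>F i. \<epsilon> ^ c \<le> \<bar>contraction_on K w y\<bar>"
      using y unfolding I_def Bad_def by (auto simp: not_less)
    then obtain w where w: "\<And>i. i \<in> I \<Longrightarrow> w i \<in> F i"
      "\<And>i. i \<in> I \<Longrightarrow> \<epsilon> ^ c \<le> \<bar>contraction_on K (w i) y\<bar>"
      by metis
    define v :: "nat \<Rightarrow> real ^ 'n" where "v i = (\<chi> j. contraction_on K (slice K k j (S i (w i))) y)" for i
    define \<gamma> where "\<gamma> = sqrt t * \<epsilon> ^ c"
    have \<gamma>: "0 < \<gamma>" using t pos by (simp add: \<gamma>_def)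
    have v_large: "\<gamma> \<le> \<bar>v i $ p i\<bar>" if "i \<in> I" for i
    proof -
      have "\<gamma> \<le> sqrt t * \<bar>contraction_on K (w i) y\<bar>"
        unfolding \<gamma>_def using t w(2)[OF that] by (intro mult_left_mono) auto
      also have "\<dots> \<le> \<bar>v i $ p i\<bar>"
        using large[of i "w i" y] w(1)[OF that] that I by (auto simp: v_def)
      finally show ?thesis .
    qed
    have v_zero: "v i $ p i' = 0" if "i \<in> I" "i' < i" for i i'
      using zero[of i i' "w i"] w(1)[OF that(1)] that I by (auto simp: v_def)
    have v_inner: "contraction_on (insert k K) (S i (w i)) (y(k := z)) = v i \<bullet> z" for i z
      by (simp add: contraction_on_insert[OF k] contraction_on_fun_upd[OF k] v_def inner_vec_def mult.commute)
    let ?Z = "{z. \<forall>i\<in>I. \<bar>v i \<bullet> z\<bar> < \<epsilon> ^ Suc c}"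
    have "?Z \<in> sets borel"
      using I(1) by measurable
    then have Z: "?Z \<in> sets (\<nu> k)" by (simp add: \<nu>_sets)
    have "(\<integral>\<^sup>+ z. indicator Fail (y(k := z)) \<partial>\<nu> k) \<le> (\<integral>\<^sup>+ z. indicator ?Z z \<partial>\<nu> k)"
      using w(1) I unfolding v_inner[symmetric] Fail_def
      by (intro nn_integral_mono) (auto simp: indicator_def)
    also have "\<dots> = ennreal (measure (\<nu> k) ?Z)"
      using Z by (simp add: finite_measure.emeasure_eq_measure[OF prob_space.finite_measure[OF \<nu>_prob]])
    also have "\<dots> \<le> ennreal (h y)"
    proof (rule ennreal_leI)
      have "measure (\<nu> k) ?Z \<le> (\<kappa> * \<epsilon> ^ Suc c / \<gamma>) ^ card I"
        using I(1) \<gamma> pos v_large v_zero by (intro anti_concentratedD[OF \<nu>, where p = p]) auto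
      also have "\<dots> \<le> q ^ card I"
      proof (rule power_mono)
        \<comment> \<open>The pivots are of size \<open>\<epsilon> ^ c\<close>, so one factor
          \<open>\<epsilon>\<close> remains; hence the threshold shrinks by
          \<open>\<epsilon>\<close> per mode.\<close>
        have "\<kappa> * \<epsilon> ^ Suc c / \<gamma> = \<kappa> * \<epsilon> / sqrt t"
          using pos t by (simp add: \<gamma>_def)
        also have "\<dots> \<le> q"
          using \<kappa> t by (simp add: pos_divide_le_eq)
        finally show "\<kappa> * \<epsilon> ^ Suc c / \<gamma> \<le> q" .
      qed (use pos \<gamma> in simp)
      also have "\<dots> \<le> h y"
      proof -
        have "(\<Sum>i<s. indicator (Bad i) y) = real (card ({..<s} - I))"
          by (subst sum.mono_neutral_cong_right[of _ "{..<s} - I" _ "\<lambda>_. 1"])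
            (auto simp: I_def indicator_def)
        also have "card ({..<s} - I) = s - card I"
          using I by (simp add: card_Diff_subset)
        finally have "real s * h y = real (s - card I) + real s * q ^ s"
          using s by (simp add: h_def sum.distrib)
        then have "real s * q ^ card I \<le> real s * h y"
          using power_convexity[of q "card I" s] pos card_mono[OF _ I(2)] by simp
        then show ?thesis using s by simp
      qed
      finally show "measure (\<nu> k) ?Z \<le> h y" .
    qed
    finally show ?thesis .
  qed
  have h_nonneg: "0 \<le> h y" for y
    unfolding h_def using pos by (intro divide_nonneg_nonneg sum_nonneg add_nonneg_nonneg) auto
  have h_int: "has_bochner_integral ?P h ((\<Sum>i<s. measure ?P (Bad i) + q ^ s) / real s)"
  proof -
    have "has_bochner_integral ?P (indicator (Bad i)) (measure ?P (Bad i))" if "i < s" for i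
      using Bad[OF that] PK.emeasure_finite[of "Bad i"]
      by (intro has_bochner_integral_real_indicator) (auto simp: less_top[symmetric])
    moreover have "has_bochner_integral ?P (\<lambda>_. q ^ s) (q ^ s)"
      using PK.prob_space by (auto simp: has_bochner_integral_iff)
    ultimately show ?thesis
      unfolding h_def by (intro has_bochner_integral_divide_zero has_bochner_integral_sum has_bochner_integral_add) auto
  qed
  have "emeasure ?Q Fail = (\<integral>\<^sup>+ y. \<integral>\<^sup>+ z. indicator Fail (y(k := z)) \<partial>\<nu> k \<partial>?P)"
    using product_nn_integral_insert[of K k "indicator Fail"] k Fail by simp
  also have "\<dots> \<le> (\<integral>\<^sup>+ y. ennreal (h y) \<partial>?P)"
    by (intro nn_integral_mono slice_le)
  also have "\<dots> = ennreal ((\<Sum>i<s. measure ?P (Bad i) + q ^ s) / real s)"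
    using h_int h_nonneg by (subst nn_integral_eq_integral) (auto simp: has_bochner_integral_iff)
  also have "\<dots> \<le> ennreal (B + q ^ s)"
  proof (rule ennreal_leI)
    have "(\<Sum>i<s. measure ?P (Bad i) + q ^ s) \<le> (\<Sum>i<s. B + q ^ s)"
      using bad by (intro sum_mono add_right_mono) (auto simp: Bad_def)
    then show "(\<Sum>i<s. measure ?P (Bad i) + q ^ s) / real s \<le> B + q ^ s"
      using s by (simp add: field_simps)
  qed
  finally have "emeasure ?Q Fail \<le> ennreal (B + q ^ s)" .
  moreover have "0 \<le> B"
    using bad[OF s] measure_nonneg order_trans by blast
  ultimately show ?thesis
    using pos unfolding Fail_def[symmetric] measure_def by (intro enn2real_leI) auto
qed

text \<open>Dominance makes the slice at least \<open>sqrt t\<close> times as long as the tensor, so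
  slicing is injective on \<open>U\<close>. A unit slice thus comes from a tensor of norm at most
  \<open>1 / sqrt t\<close>, and normalizing that tensor costs at most a factor
  \<open>sqrt t\<close>.\<close>

lemma dominant_slice_lift:
  fixes U :: "('l::finite, 'n::finite) tensor set"
  assumes k: "k \<notin> K" and U: "subspace U" "U \<subseteq> tensors_on (insert k K)" and t: "0 < t"
    and dom: "\<And>T. T \<in> U \<Longrightarrow> t * (T \<bullet> T) \<le> T \<bullet> restrict_mode k j T"
  shows "dim (slice K k j ` U) = dim U"
    and "w \<in> slice K k j ` U \<Longrightarrow> norm w = 1 \<Longrightarrow> \<exists>S\<in>U. norm S = 1 \<and>
      (\<forall>y. sqrt t * \<bar>contraction_on K w y\<bar> \<le> \<bar>contraction_on K (slice K k j S) y\<bar>)"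
proof -
  have le: "t * (T \<bullet> T) \<le> slice K k j T \<bullet> slice K k j T" if "T \<in> U" for T
    using dom[OF that] slice_inner_slice[OF k] U(2) that by (metis subsetD)
  have ker: "T = 0" if "T \<in> U" "slice K k j T = 0" for T
  proof -
    have "t * (T \<bullet> T) \<le> 0" using le[OF that(1)] that(2) by simp
    then have "T \<bullet> T \<le> 0"
      using t by (simp add: mult_le_0_iff)
    then have "T \<bullet> T = 0"
      using inner_ge_zero[of T] by linarith
    then show ?thesis by simp
  qed
  then have "inj_on (slice K k j) (span U)"
    using U(1) by (subst linear_injective_on_subspace_0[OF linear_slice])
      (auto simp: span_eq_iff[THEN iffD2])
  then show "dim (slice K k j ` U) = dim U"
    by (rule dim_image_eq[OF linear_slice])
  assume "w \<in> slice K k j ` U" and w1: "norm w = 1"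
  then obtain T where T: "T \<in> U" "slice K k j T = w" by auto
  have "w \<noteq> 0" using w1 by auto
  then have T0: "0 < norm T"
    using T linear_0[OF linear_slice] by (metis zero_less_norm_iff)
  have "t * (norm T)\<^sup>2 \<le> 1"
    using le[OF T(1)] T(2) w1 by (simp add: power2_norm_eq_inner norm_eq_1)
  then have "sqrt (t * (norm T)\<^sup>2) \<le> 1"
    by simp
  then have bound: "sqrt t * norm T \<le> 1"
    by (simp add: real_sqrt_mult)
  let ?S = "(1 / norm T) *\<^sub>R T"
  have "slice K k j ?S = (1 / norm T) *\<^sub>R w"
    using linear_scale[OF linear_slice] T(2) by metis
  then have "\<bar>contraction_on K (slice K k j ?S) y\<bar> = \<bar>contraction_on K w y\<bar> / norm T" for y
    by (simp add: contraction_on_scaleR)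
  moreover have "sqrt t * a \<le> a / norm T" if "0 \<le> a" for a
    using mult_right_mono[OF bound that] T0 by (simp add: field_simps)
  ultimately have "\<forall>y. sqrt t * \<bar>contraction_on K w y\<bar> \<le> \<bar>contraction_on K (slice K k j ?S) y\<bar>"
    by simp
  moreover have "?S \<in> U" "norm ?S = 1"
    using T(1) U(1) T0 by (auto intro: subspace_scale)
  ultimately show "\<exists>S\<in>U. norm S = 1 \<and>
      (\<forall>y. sqrt t * \<bar>contraction_on K w y\<bar> \<le> \<bar>contraction_on K (slice K k j S) y\<bar>)"
    by blast
qed

text \<open>All laws, scales and probabilities are quantified after \<open>F\<close>, so that the
  tensors can be chosen before the vectors and \<open>\<rho>\<close>. The number \<open>q\<close>
  bounds the failure of a single form, and each mode contributes \<open>q ^ s\<close>.\<close>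

definition small_ball_bound ::
    "real \<Rightarrow> nat \<Rightarrow> 'l set \<Rightarrow> ('l::finite, 'n::finite) tensor set \<Rightarrow> bool" where
  "small_ball_bound t s K F \<longleftrightarrow>
    (\<forall>\<nu> \<kappa> \<epsilon> q. (\<forall>k. anti_concentrated \<kappa> (\<nu> k)) \<longrightarrow> 0 < \<kappa> \<longrightarrow> 0 < \<epsilon> \<longrightarrow> 0 < q \<longrightarrow> q \<le> 1 \<longrightarrow>
      \<kappa> * \<epsilon> \<le> q * sqrt t \<longrightarrow>
      measure (PiM K \<nu>) {y \<in> space (PiM K \<nu>). \<forall>T\<in>F. \<bar>contraction_on K T y\<bar> < \<epsilon> ^ card K}
        \<le> real (card K) * q ^ s)"

lemma small_ball_boundD:
  assumes "small_ball_bound t s K F" "\<And>k. anti_concentrated \<kappa> (\<nu> k)" "0 < \<kappa>" "0 < \<epsilon>" "0 < q" "q \<le> 1"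
    "\<kappa> * \<epsilon> \<le> q * sqrt t"
  shows "measure (PiM K \<nu>) {y \<in> space (PiM K \<nu>). \<forall>T\<in>F. \<bar>contraction_on K T y\<bar> < \<epsilon> ^ card K}
    \<le> real (card K) * q ^ s"
  using assms unfolding small_ball_bound_def by blast

text \<open>The induction on the modes. The family for \<open>insert k K\<close> consists of lifts
  of the families that the induction hypothesis gives for the slices of the subspaces
  \<open>U i\<close>.\<close>

lemma contraction_small_ball:
  fixes V :: "('l::finite, 'n::finite) tensor set"
  assumes "finite K" and t: "0 < t" "t * real CARD('n) < 1"
    and "subspace V" "V \<subseteq> tensors_on K" "r * (card K * CARD('n) ^ (card K - 1)) < dim V"
  shows "\<exists>F. finite F \<and> F \<subseteq> V \<and> (\<forall>T\<in>F. norm T = 1) \<and>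
    small_ball_bound t (Suc r) K F"
  using assms(1,4-6)
proof (induction K arbitrary: V rule: finite_induct)
  case empty
  have "\<not> V \<subseteq> {0}"
    using empty.prems(3) dim_eq_0[of V] by linarith
  then obtain T where T: "T \<in> V" "T \<noteq> 0" by auto
  define S where "S = (1 / norm T) *\<^sub>R T"
  have S: "S \<in> V" "norm S = 1"
    using T empty.prems(1) by (auto simp: S_def intro: subspace_scale)
  \<comment> \<open>Without modes there is a single extensional index, so a unit tensor contracts to
    1 or -1. This is never below \<open>\<epsilon> ^ 0\<close>, and the failure probability is
    exactly 0.\<close>
  have "S \<bullet> S = (S $ (\<lambda>_. undefined)) * (S $ (\<lambda>_. undefined))"
    using inner_tensors_on[of S "{}" S] S(1) empty.prems(2) by auto
  then have "(S $ (\<lambda>_. undefined))\<^sup>2 = 1"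
    using S(2) by (simp add: norm_eq_1 power2_eq_square)
  then have "\<bar>contraction_on {} S y\<bar> = 1" for y
    unfolding contraction_on_def by (auto simp: power2_eq_1_iff)
  then show ?case
    using S by (intro exI[of _ "{S}"]) (auto simp: small_ball_bound_def)
next
  case (insert k K)
  let ?n = "CARD('n)" and ?w = "card K * CARD('n) ^ (card K - 1)"
  \<comment> \<open>The recurrence behind the dimension condition: \<open>?n ^ card K\<close> pays
    for killing one slice, and \<open>?n * ?w\<close> for passing to a dominant slice that still
    satisfies the condition for \<open>K\<close>.\<close>
  have weight: "card (insert k K) * ?n ^ (card (insert k K) - 1) = ?n * ?w + ?n ^ card K"
    using insert.hyps by (cases "card K") (auto simp: algebra_simps)
  have "Suc r * ?n ^ card K + ?n * (r * ?w) < dim V + ?n ^ card K"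
    using insert.prems(3) unfolding weight by (simp add: algebra_simps)
  from triangular_system[OF insert.hyps(2) insert.prems(1,2) t(2) this]
  obtain p :: "nat \<Rightarrow> 'n" and U where "\<forall>i<Suc r. subspace (U i) \<and> U i \<subseteq> V \<and> r * ?w < dim (U i) \<and>
    (\<forall>T\<in>U i. t * (T \<bullet> T) \<le> T \<bullet> restrict_mode k (p i) T) \<and>
    (\<forall>i'<i. \<forall>T\<in>U i. restrict_mode k (p i') T = 0)"
    by (elim exE)
  then have U: "\<And>i. i < Suc r \<Longrightarrow> subspace (U i)" "\<And>i. i < Suc r \<Longrightarrow> U i \<subseteq> V"
    "\<And>i. i < Suc r \<Longrightarrow> r * ?w < dim (U i)"
    "\<And>i T. i < Suc r \<Longrightarrow> T \<in> U i \<Longrightarrow> t * (T \<bullet> T) \<le> T \<bullet> restrict_mode k (p i) T"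
    "\<And>i i' T. i < Suc r \<Longrightarrow> i' < i \<Longrightarrow> T \<in> U i \<Longrightarrow> restrict_mode k (p i') T = 0"
    by auto
  have kernel: "dim (slice K k (p i) ` U i) = dim (U i)"
    "\<And>w. w \<in> slice K k (p i) ` U i \<Longrightarrow> norm w = 1 \<Longrightarrow> \<exists>S\<in>U i. norm S = 1 \<and>
      (\<forall>y. sqrt t * \<bar>contraction_on K w y\<bar> \<le> \<bar>contraction_on K (slice K k (p i) S) y\<bar>)"
    if "i < Suc r" for i
    by (rule dominant_slice_lift[OF insert.hyps(2) U(1)[OF that] order_trans[OF U(2)[OF that] insert.prems(2)]
        t(1) U(4)[OF that]]; assumption)+
  have "\<forall>i\<in>{..<Suc r}. \<exists>F. finite F \<and> F \<subseteq> slice K k (p i) ` U i \<and> (\<forall>T\<in>F. norm T = 1) \<and>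
    small_ball_bound t (Suc r) K F"
  proof
    fix i assume "i \<in> {..<Suc r}"
    then have i: "i < Suc r" by simp
    show "\<exists>F. finite F \<and> F \<subseteq> slice K k (p i) ` U i \<and> (\<forall>T\<in>F. norm T = 1) \<and>
      small_ball_bound t (Suc r) K F"
    proof (rule insert.IH)
      show "subspace (slice K k (p i) ` U i)"
        by (rule linear_subspace_image[OF linear_slice U(1)[OF i]])
      show "slice K k (p i) ` U i \<subseteq> tensors_on K"
        using slice_in_tensors_on by auto
      show "r * ?w < dim (slice K k (p i) ` U i)"
        using kernel(1)[OF i] U(3)[OF i] by simp
    qed
  qed
  from bchoice[OF this] obtain F where "\<forall>i\<in>{..<Suc r}. finite (F i) \<and> F i \<subseteq> slice K k (p i) ` U i \<and> (\<forall>T\<in>F i. norm T = 1) \<and>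
    small_ball_bound t (Suc r) K (F i)" ..
  then have F: "\<And>i. i < Suc r \<Longrightarrow> finite (F i)" "\<And>i. i < Suc r \<Longrightarrow> F i \<subseteq> slice K k (p i) ` U i"
    "\<And>i w. i < Suc r \<Longrightarrow> w \<in> F i \<Longrightarrow> norm w = 1"
    and tail: "\<And>i. i < Suc r \<Longrightarrow> small_ball_bound t (Suc r) K (F i)"
    by auto
  have "\<exists>S\<in>U i. norm S = 1 \<and>
      (\<forall>y. sqrt t * \<bar>contraction_on K w y\<bar> \<le> \<bar>contraction_on K (slice K k (p i) S) y\<bar>)"
    if "i < Suc r" "w \<in> F i" for i w
    using kernel(2)[OF that(1)] F(2)[OF that(1)] F(3)[OF that] that(2) by blast
  then obtain S where S: "\<And>i w. i < Suc r \<Longrightarrow> w \<in> F i \<Longrightarrow> S i w \<in> U i"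
    "\<And>i w. i < Suc r \<Longrightarrow> w \<in> F i \<Longrightarrow> norm (S i w) = 1"
    "\<And>i w y. i < Suc r \<Longrightarrow> w \<in> F i \<Longrightarrow>
      sqrt t * \<bar>contraction_on K w y\<bar> \<le> \<bar>contraction_on K (slice K k (p i) (S i w)) y\<bar>"
    by metis
  define G where "G = (\<Union>i<Suc r. S i ` F i)"
  have "finite G" "G \<subseteq> V" "\<forall>T\<in>G. norm T = 1"
    using F(1) S(2) subsetD[OF U(2) S(1)] by (auto simp: G_def)
  moreover have "measure (PiM (insert k K) \<nu>) {y \<in> space (PiM (insert k K) \<nu>).
      \<forall>T\<in>G. \<bar>contraction_on (insert k K) T y\<bar> < \<epsilon> ^ card (insert k K)} \<le> real (card (insert k K)) * q ^ Suc r"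
    if \<nu>: "\<forall>k. anti_concentrated \<kappa> (\<nu> k)" and pos: "0 < \<kappa>" "0 < \<epsilon>" "0 < q" "q \<le> 1" "\<kappa> * \<epsilon> \<le> q * sqrt t"
    for \<nu> \<kappa> \<epsilon> q
  proof -
    have "measure (PiM (insert k K) \<nu>) {y \<in> space (PiM (insert k K) \<nu>).
      \<forall>i<Suc r. \<forall>w\<in>F i. \<bar>contraction_on (insert k K) (S i w) y\<bar> < \<epsilon> ^ Suc (card K)}
      \<le> real (card K) * q ^ Suc r + q ^ Suc r"
    proof (rule contraction_small_ball_step[OF insert.hyps(2) t(1) _ pos])
      show "slice K k (p i') (S i w) = 0" if "i < Suc r" "i' < i" "w \<in> F i" for i i' w
        using U(5)[OF that(1,2) S(1)[OF that(1,3)]] by (rule slice_eq_0)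
      show "measure (PiM K \<nu>) {y \<in> space (PiM K \<nu>). \<forall>w\<in>F i. \<bar>contraction_on K w y\<bar> < \<epsilon> ^ card K}
          \<le> real (card K) * q ^ Suc r" if "i < Suc r" for i
        using \<nu> by (intro small_ball_boundD[OF tail[OF that] _ pos]) blast
    qed (use \<nu> F(1) S(3) in auto)
    moreover have "{y \<in> space (PiM (insert k K) \<nu>).
      \<forall>i<Suc r. \<forall>w\<in>F i. \<bar>contraction_on (insert k K) (S i w) y\<bar> < \<epsilon> ^ Suc (card K)}
      = {y \<in> space (PiM (insert k K) \<nu>).
      \<forall>T\<in>G. \<bar>contraction_on (insert k K) T y\<bar> < \<epsilon> ^ card (insert k K)}"
      using insert.hyps by (auto simp: G_def)
    ultimately show ?thesis
      using insert.hyps by (simp add: algebra_simps)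
  qed
  ultimately show ?case
    unfolding small_ball_bound_def by (intro exI[of _ G]) blast
qed

subsection \<open>Parameters\<close>

text \<open>The left side is the exponent of \<open>1 / n\<close> that the argument produces, the
  right side the exponent allowed.\<close>

lemma modes_le_power3: "L * (L + 2) \<le> (3::nat) ^ L"
proof (induction L)
  case (Suc L)
  show ?case
  proof (cases "L = 0")
    case False
    then have "2 * L + 3 \<le> 2 * (L * (L + 2))"
      by (cases L) (auto simp: algebra_simps)
    then show ?thesis using Suc by (simp add: algebra_simps)
  qed simp
qed simp

text \<open>For \<open>L\<close> at least 2 this is weighted AM-GM between \<open>n\<close> and 1,
  the weight of \<open>n\<close> being at most \<open>1 / (4 * L)\<close>.\<close>

lemma powr_le_linear:
  fixes n :: real
  assumes "1 \<le> n" "1 \<le> L"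
  shows "n powr (1 / (2 * real L) ^ L) \<le> (if L = 1 then n else 1 + n / (4 * real L))"
proof (cases "L = 1")
  case True
  then show ?thesis
    using powr_mono[of "1 / 2" 1 n] assms by simp
next
  case False
  then have L: "2 \<le> L" using assms by simp
  define a where "a = 1 / (2 * real L) ^ L"
  have "(2 * real L) ^ 2 \<le> (2 * real L) ^ L"
    using L by (intro power_increasing) auto
  moreover have "4 * real L \<le> (2 * real L) ^ 2"
    using L by (simp add: power2_eq_square)
  ultimately have le: "4 * real L \<le> (2 * real L) ^ L" by linarith
  have a: "0 \<le> a" "a \<le> 1 / (4 * real L)"
    unfolding a_def using L le by (auto intro!: divide_left_mono)
  have "1 / (4 * real L) \<le> 1" using L by simp
  then have "a \<le> 1" using a(2) by linarith
  then have "n powr a * 1 powr (1 - a) \<le> a * n + (1 - a) * 1"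
    using assms a by (intro Youngs_inequality_0) auto
  also have "\<dots> \<le> 1 + 1 / (4 * real L) * n"
    using a assms mult_right_mono[OF a(2), of n] by simp
  finally show ?thesis
    using False by (simp add: a_def)
qed

text \<open>From \<open>exp 1 \<le> 3\<close> and 243 < 256, that is,
  \<open>3 ^ 5 \<le> 4 ^ 4\<close>.\<close>

lemma exp_le_4_power: "exp (5 / 4 * real s) \<le> 4 ^ s"
proof -
  have "exp (5 / 4 :: real) ^ 4 = exp 1 ^ 5"
    by (simp flip: exp_of_nat_mult)
  also have "\<dots> \<le> (3::real) ^ 5"
    by (intro power_mono exp_le) auto
  also have "\<dots> \<le> 4 ^ 4" by simp
  finally have "exp (5 / 4 :: real) \<le> 4"
    using power_mono_iff[of "exp (5 / 4 :: real)" 4 4] by simp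
  then have "exp (5 / 4 :: real) ^ s \<le> 4 ^ s"
    by (intro power_mono) auto
  then show ?thesis
    by (simp add: mult.commute flip: exp_of_nat_mult)
qed

text \<open>Explains the exponent \<open>L + 1\<close>: the factor \<open>L\<close> is absorbed by
  \<open>n ^ (L - 1)\<close>, and the exponential by \<open>4 ^ s\<close>, hence by
  \<open>(n ^ 2) ^ s\<close>.\<close>

lemma tail_le_exp:
  fixes \<delta> :: real
  assumes "0 < \<delta>" "\<delta> < 1" "2 \<le> n" "1 \<le> L" "1 \<le> s" and s: "\<delta> * real n / real L \<le> real s"
  shows "real L * (1 / real n ^ (L + 1)) ^ s \<le> exp (- \<delta> * real n powr (1 / (2 * real L) ^ L))"
proof -
  have "\<delta> * real n powr (1 / (2 * real L) ^ L) \<le> 5 / 4 * real s"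
  proof (cases "L = 1")
    case True
    have "\<delta> * real n powr (1 / (2 * real L) ^ L) \<le> \<delta> * real n"
      using powr_le_linear[of "real n" L] assms True by (intro mult_left_mono) auto
    then show ?thesis using s True by simp
  next
    case False
    have "\<delta> * real n powr (1 / (2 * real L) ^ L) \<le> \<delta> * (1 + real n / (4 * real L))"
      using powr_le_linear[of "real n" L] assms False by (intro mult_left_mono) auto
    also have "\<dots> = \<delta> + (\<delta> * real n / real L) / 4"
      by (simp add: field_simps)
    \<comment> \<open>\<open>\<delta> < 1 \<le> s\<close> bounds the first summand by
      \<open>s\<close>, the second is at most \<open>s / 4\<close>.\<close>
    finally show ?thesis using s assms by simp
  qed
  then have "exp (\<delta> * real n powr (1 / (2 * real L) ^ L)) \<le> exp (5 / 4 * real s)"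
    by simp
  also have "\<dots> \<le> 4 ^ s"
    by (rule exp_le_4_power)
  also have "\<dots> \<le> (real n ^ 2) ^ s"
    using power_mono[of 2 "real n" 2] assms by (intro power_mono) auto
  finally have 1: "exp (\<delta> * real n powr (1 / (2 * real L) ^ L)) \<le> (real n ^ 2) ^ s" .
  have "real L \<le> 2 ^ (L - 1)"
    using less_exp[of "L - 1"] assms by (metis Suc_leI le_add_diff_inverse of_nat_le_iff of_nat_numeral of_nat_power plus_1_eq_Suc)
  also have "\<dots> \<le> real n ^ (L - 1)"
    using assms by (intro power_mono) auto
  also have "\<dots> \<le> (real n ^ (L - 1)) ^ s"
    using assms by (intro self_le_power one_le_power) auto
  finally have 2: "real L \<le> (real n ^ (L - 1)) ^ s" .
  have "real L * exp (\<delta> * real n powr (1 / (2 * real L) ^ L)) \<le> (real n ^ (L - 1)) ^ s * (real n ^ 2) ^ s"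
    by (intro mult_mono 1 2) auto
  also have "\<dots> = (real n ^ (L + 1)) ^ s"
    using assms by (simp flip: power_mult_distrib power_add)
  finally have "real L * exp (\<delta> * real n powr (1 / (2 * real L) ^ L)) \<le> (real n ^ (L + 1)) ^ s" .
  then show ?thesis
    using assms by (simp add: exp_minus field_simps power_divide)
qed

section \<open>Choice of parameters and transfer to the law of the perturbed vectors\<close>

theorem mainTheorem8:
  fixes \<delta> :: real
    and V :: "('l::finite, 'n::finite) tensor set"
  assumes "0 < \<delta>" and "\<delta> < 1"
    and "subspace V"
    and "real (dim V) = \<delta> * real CARD('n) ^ CARD('l)"
  shows "\<exists>(r::nat) (T :: nat \<Rightarrow> ('l, 'n) tensor).
    (\<forall>j\<in>{1..r}. T j \<in> V \<and> norm (T j) = 1) \<and>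
    (\<forall>(\<rho>::real) (x :: 'l \<Rightarrow> real ^ 'n) (M :: 'w measure) (X :: 'l \<Rightarrow> 'w \<Rightarrow> real ^ 'n).
       0 < \<rho> \<and> prob_space M \<and>
       (\<forall>k. rho_perturbation M \<rho> (x k) (X k)) \<and>
       prob_space.indep_vars M (\<lambda>_. borel) X UNIV \<longrightarrow>
       measure M {\<omega> \<in> space M. \<exists>j\<in>{1..r}.
           \<bar>contraction (T j) (\<lambda>k. X k \<omega>)\<bar>
             \<ge> \<rho> ^ CARD('l) * (1 / real CARD('n)) ^ (3 ^ CARD('l))}
         \<ge> 1 - exp (- \<delta> * real CARD('n) powr (1 / (2 * real CARD('l)) ^ CARD('l))))"
proof -
  let ?n = "CARD('n)" and ?L = "CARD('l)"
  \<comment> \<open>For \<open>?n = 1\<close> the dimension would be \<open>\<delta>\<close>,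
    strictly between 0 and 1.\<close>
  have "?n \<noteq> 1"
  proof
    assume "?n = 1"
    then have "real (dim V) = \<delta>" using assms(4) by simp
    then show False using assms(1,2) by (metis of_nat_0_less_iff of_nat_less_1_iff less_one not_less_zero)
  qed
  then have n: "2 \<le> ?n"
    using zero_less_card_finite[where 'a = 'n] by linarith
  have L: "1 \<le> ?L"
    using zero_less_card_finite[where 'a = 'l] by linarith
  \<comment> \<open>Rounding up serves both sides: \<open>s\<close> is large enough for the tail,
    while \<open>s - 1\<close> stays strictly below the quotient, as the dimension condition
    demands.\<close>
  define s where "s = nat \<lceil>\<delta> * real ?n / real ?L\<rceil>"
  have pos: "0 < \<delta> * real ?n / real ?L"
    using assms(1) n L by simp
  then have s: "1 \<le> s" "\<delta> * real ?n / real ?L \<le> real s" "real (s - 1) < \<delta> * real ?n / real ?L"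
    unfolding s_def by linarith+
  have "real (s - 1) * real ?L < \<delta> * real ?n"
    using s(3) L by (simp add: pos_less_divide_eq)
  then have "real (s - 1) * real ?L * real ?n ^ (?L - 1) < \<delta> * real ?n * real ?n ^ (?L - 1)"
    using n by (intro mult_strict_right_mono) auto
  also have "\<dots> = \<delta> * real ?n ^ ?L"
    using L by (simp add: mult.assoc flip: power_Suc)
  finally have "real ((s - 1) * (?L * ?n ^ (?L - 1))) < real (dim V)"
    unfolding assms(4) by (simp add: mult.assoc)
  then have dim: "(s - 1) * (?L * ?n ^ (?L - 1)) < dim V"
    unfolding of_nat_less_iff .
  \<comment> \<open>\<open>t n < 1\<close> must be strict; the constant \<open>2 / pi\<close> of the Gaussian density leaves exactly this room.\<close>
  define t where "t = 2 / (pi * real ?n)"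
  have t: "0 < t" "t * real ?n < 1"
    using n pi_gt3 by (auto simp: t_def)
  have "V \<subseteq> tensors_on UNIV"
    by (auto simp: tensors_on_def)
  from contraction_small_ball[OF finite t assms(3) this dim]
  obtain F where F: "finite F" "F \<subseteq> V" "\<And>T. T \<in> F \<Longrightarrow> norm T = 1"
    and tail: "small_ball_bound t (Suc (s - 1)) UNIV F"
    by blast
  obtain T where T: "bij_betw T {1..card F} F"
    using ex_bij_betw_nat_finite_1[OF F(1)] by blast
  have T_F: "T ` {1..card F} = F"
    using T by (simp add: bij_betw_def)
  define q where "q = 1 / real ?n ^ (?L + 1)"
  have q: "0 < q" "q \<le> 1"
    using n one_le_power[of "real ?n" "?L + 1"] by (auto simp: q_def simp del: power_Suc)
  show ?thesis
  proof (intro exI[of _ "card F"] exI[of _ T] conjI ballI allI impI)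
    fix j assume "j \<in> {1..card F}"
    then have "T j \<in> F" using T_F by blast
    then show "T j \<in> V" "norm (T j) = 1" using F by auto
  next
    fix \<rho> :: real and x :: "'l \<Rightarrow> real ^ 'n" and M :: "'w measure" and X :: "'l \<Rightarrow> 'w \<Rightarrow> real ^ 'n"
    assume asm: "0 < \<rho> \<and> prob_space M \<and> (\<forall>k. rho_perturbation M \<rho> (x k) (X k)) \<and>
       prob_space.indep_vars M (\<lambda>_. borel) X UNIV"
    then have \<rho>: "0 < \<rho>" by blast
    interpret prob_space M using asm by blast
    have indep: "indep_vars (\<lambda>_. borel) X UNIV" using asm by blast
    have X: "X k \<in> borel_measurable M" for k
      using indep unfolding indep_vars_def by auto
    define \<nu> where "\<nu> = (\<lambda>k. distr M borel (X k))"
    \<comment> \<open>Independence of the perturbed vectors makes their joint law the product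
      measure of the small ball bound.\<close>
    have law: "distr M (\<Pi>\<^sub>M k\<in>UNIV. borel) (\<lambda>\<omega>. \<lambda>k\<in>UNIV. X k \<omega>) = PiM UNIV \<nu>"
      using indep_vars_iff_distr_eq_PiM[where I = UNIV and M' = "\<lambda>_. borel" and X = X] X indep
      by (simp add: \<nu>_def)
    have \<nu>_sets: "sets (\<nu> k) = sets borel" for k by (simp add: \<nu>_def)
    define \<kappa> where "\<kappa> = sqrt (2 / pi) * sqrt (real ?n) / \<rho>"
    have \<kappa>: "0 < \<kappa>" using \<rho> n by (simp add: \<kappa>_def)
    have anti: "anti_concentrated \<kappa> (\<nu> k)" for k
      unfolding \<nu>_def \<kappa>_def using asm X prob_space_axioms
      by (intro rho_perturbation_anti_concentrated) auto
    \<comment> \<open>Solves \<open>\<kappa> * \<epsilon> = q * sqrt t\<close>; since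
      \<open>q\<close> is \<open>1 / ?n ^ (?L + 1)\<close>, this is
      \<open>\<rho> / ?n ^ (?L + 2)\<close>.\<close>
    define \<epsilon> where "\<epsilon> = \<rho> * q / real ?n"
    have \<epsilon>: "0 < \<epsilon>" using \<rho> q n by (simp add: \<epsilon>_def)
    have \<kappa>\<epsilon>: "\<kappa> * \<epsilon> \<le> q * sqrt t"
    proof -
      have "\<kappa> * \<epsilon> = q * (sqrt (2 / pi) * (sqrt (real ?n) / real ?n))"
        using \<rho> by (simp add: \<kappa>_def \<epsilon>_def)
      also have "sqrt (real ?n) / real ?n = 1 / sqrt (real ?n)"
        using sqrt_divide_self_eq[of "real ?n"] by (simp add: inverse_eq_divide)
      also have "q * (sqrt (2 / pi) * (1 / sqrt (real ?n))) = q * sqrt t"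
        by (simp add: t_def real_sqrt_mult real_sqrt_divide)
      finally show ?thesis by simp
    qed
    let ?B = "{y \<in> space (PiM UNIV \<nu>). \<forall>T\<in>F. \<bar>contraction_on UNIV T y\<bar> < \<epsilon> ^ ?L}"
    have "contraction_on UNIV T \<in> borel_measurable (PiM UNIV \<nu>)" for T
      by (rule borel_measurable_contraction_on[OF \<nu>_sets])
    then have B: "?B \<in> sets (PiM UNIV \<nu>)"
      using F(1) by (intro sets.sets_Collect_finite_All) measurable
    have Xm: "(\<lambda>\<omega>. \<lambda>k\<in>UNIV. X k \<omega>) \<in> measurable M (\<Pi>\<^sub>M k\<in>UNIV. borel)"
      using X by measurable
    have contr: "contraction_on UNIV T (\<lambda>k\<in>UNIV. X k \<omega>) = contraction T (\<lambda>k. X k \<omega>)" for T \<omega>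
      by (simp add: contraction_on_def contraction_def PiE_UNIV)
    let ?A = "{\<omega> \<in> space M. \<forall>T\<in>F. \<bar>contraction T (\<lambda>k. X k \<omega>)\<bar> < \<epsilon> ^ ?L}"
    have A_eq: "?A = (\<lambda>\<omega>. \<lambda>k\<in>UNIV. X k \<omega>) -` ?B \<inter> space M"
      by (auto simp: contr[symmetric] space_PiM \<nu>_def)
    have "measure (PiM UNIV \<nu>) ?B = measure M ?A"
      unfolding A_eq using B unfolding law[symmetric] by (subst measure_distr[OF Xm]) auto
    then have A_le: "measure M ?A \<le> exp (- \<delta> * real ?n powr (1 / (2 * real ?L) ^ ?L))"
      using small_ball_boundD[where \<nu> = \<nu>, OF tail anti \<kappa> \<epsilon> q \<kappa>\<epsilon>] tail_le_exp[OF assms(1,2) n L s(1,2)] s(1)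
      by (simp add: q_def)
    have A: "?A \<in> events"
      unfolding A_eq using B unfolding law[symmetric] by (intro measurable_sets[OF Xm]) simp
    have thr: "\<rho> ^ ?L * (1 / real ?n) ^ 3 ^ ?L \<le> \<epsilon> ^ ?L"
    proof -
      have "\<epsilon> ^ ?L = \<rho> ^ ?L * (1 / real ?n) ^ (?L * (?L + 2))"
        by (simp add: \<epsilon>_def q_def power_mult_distrib power_divide power_mult[symmetric] mult.commute
            flip: power_Suc power_add)
      moreover have "(1 / real ?n) ^ 3 ^ ?L \<le> (1 / real ?n) ^ (?L * (?L + 2))"
        using n by (intro power_decreasing modes_le_power3) auto
      ultimately show ?thesis
        using \<rho> by (simp add: mult_left_mono)
    qed
    let ?G = "{\<omega> \<in> space M. \<exists>j\<in>{1..card F}. \<bar>contraction (T j) (\<lambda>k. X k \<omega>)\<bar>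
      \<ge> \<rho> ^ ?L * (1 / real ?n) ^ 3 ^ ?L}"
    have "(\<lambda>\<omega>. contraction T (\<lambda>k. X k \<omega>)) \<in> borel_measurable M" for T
    proof -
      have "contraction_on UNIV T \<in> borel_measurable (\<Pi>\<^sub>M k\<in>UNIV. borel)"
        by (rule borel_measurable_contraction_on) simp
      from measurable_compose[OF Xm this] show ?thesis
        by (simp only: contr)
    qed
    then have "?G \<in> events"
      by measurable
    moreover have "space M - ?A \<subseteq> ?G"
    proof
      fix \<omega> assume \<omega>: "\<omega> \<in> space M - ?A"
      then obtain S where "S \<in> F" "\<epsilon> ^ ?L \<le> \<bar>contraction S (\<lambda>k. X k \<omega>)\<bar>"
        by (auto simp: not_less)
      moreover from \<open>S \<in> F\<close> obtain j where "j \<in> {1..card F}" "S = T j"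
        using T_F by (metis imageE)
      ultimately have j: "j \<in> {1..card F}" "\<epsilon> ^ ?L \<le> \<bar>contraction (T j) (\<lambda>k. X k \<omega>)\<bar>"
        by simp_all
      have "\<rho> ^ ?L * (1 / real ?n) ^ 3 ^ ?L \<le> \<bar>contraction (T j) (\<lambda>k. X k \<omega>)\<bar>"
        using thr j(2) by (rule order_trans)
      then show "\<omega> \<in> ?G"
        using \<omega> j(1) by blast
    qed
    ultimately have "prob (space M - ?A) \<le> prob ?G"
      by (intro finite_measure_mono)
    then show "1 - exp (- \<delta> * real ?n powr (1 / (2 * real ?L) ^ ?L)) \<le> prob ?G"
      using A_le prob_compl[OF A] by linarith
  qed
qed

end
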